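(* Let $\Sigma_1,\Sigma_1',\Sigma_2,\Sigma_2'$ be $0$-asymptotically stable systems and suppose $\Sigma_1\preccurlyeq_{\gamma_1,\delta_1}\Sigma_1'$ and $\Sigma_2\preccurlyeq_{\gamma_2,\delta_2}\Sigma_2'$ for some $\gamma_1,\delta_1,\gamma_2,\delta_2>0$. Then there exist $\gamma_s,\delta_s>0$ such that $$\Sigma_1\parallel_{\mathrm{s}}\Sigma_2\preccurlyeq_{\gamma_s,\delta_s}\Sigma_1'\parallel_{\mathrm{s}}\Sigma_2'.$$
   Context: A system $\Sigma_i$ is a continuous-time linear system $\dot x_i=A_ix_i+B_iu_i+E_id_i$, $y_i=C_ix_i$ with real constant matrices, state $x_i\in\mathbb{R}^{n_i}$, input $u_i\in\mathbb{R}^{m_i}$, disturbance $d_i\in\mathbb{R}^{q_i}$, output $y_i\in\mathbb{R}^{p_i}$; it is $0$-asymptotically stable if $A_i$ is Hurwitz. $y_i(t;t_0,x_{i,0},u_i,d_i)$ denotes the output at time $t$ for $x_i(t_0)=x_{i,0}$, input $u_i$, disturbance $d_i$. $\mathcal{L}_2$ is the space of measurable (vector-valued) functions $u$ on $[0,\infty)$ with $\|u\|^2=\int_0^\infty|u(t)|^2\,dt<\infty$. $(\gamma,\delta)$-similarity. For $\gamma,\delta>0$ and $0$-asymptotically stable systems $\Sigma$ and $\Sigma'$ with equal input dimensions and equal output dimensions (signals of $\Sigma'$ carry a prime), $\Sigma\preccurlyeq_{\gamma,\delta}\Sigma'$ means: there exist constants $\varepsilon,\eta,\mu>0$ such that for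 all $u,u'\in\mathcal{L}_2$ and all $d\in\mathcal{L}_2$ there exists $d'\in\mathcal{L}_2$ with $$\|y-y'\|^2\le\gamma\|u-u'\|^2+(\delta-\varepsilon)\left\|\begin{bmatrix}u \\ u'\end{bmatrix}\right\|^2+(\mu-\varepsilon)\|d\|^2-\eta\|d'\|^2,$$ where $y,y'$ are the outputs of $\Sigma,\Sigma'$ from zero initial condition at time $0$. Series interconnection. When $p_1=m_2$, $\Sigma_1\parallel_{\mathrm{s}}\Sigma_2$ is obtained by setting $u_2=y_1$; with $x_s=\operatorname{col}(x_1,x_2)$, input $u_s=u_1$, disturbance $d_s=\operatorname{col}(d_1,d_2)$ and output $y_s=y_2$, it is the system $\dot x_s=A_sx_s+B_su_s+E_sd_s$, $y_s=C_sx_s$ with $$A_s=\begin{bmatrix}A_1&0 \\ B_2C_1&A_2\end{bmatrix},\ B_s=\begin{bmatrix}B_1 \\ 0\end{bmatrix},\ E_s=\begin{bmatrix}E_1&0 \\ 0&E_2\end{bmatrix},\ C_s=\begin{bmatrix}0&C_2\end{bmatrix}$$ (which is again $0$-asymptotically stable). $\Sigma_1'\parallel_{\mathrm{s}}\Sigma_2'$ is defined in the same way. All dimensions are assumed compatible so that both interconnections are defined. $\operatorname{col}(a,b)=(a^T,b^T)^T$. *)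

theory Defs
  imports "HOL-Analysis.Analysis"
begin

section \<open>Linear time-invariant systems\<close>

text \<open>A system \<open>x' = A x + B u + E d\<close>, \<open>y = C x\<close>; the index types stand for the
  dimensions of state, input, disturbance and output.\<close>

record ('n::finite, 'm::finite, 'q::finite, 'p::finite) lti =
  mat_A :: "real ^ 'n ^ 'n"
  mat_B :: "real ^ 'm ^ 'n"
  mat_E :: "real ^ 'q ^ 'n"
  mat_C :: "real ^ 'n ^ 'p"

definition hurwitz :: "real ^ 'n ^ 'n \<Rightarrow> bool" where
  "hurwitz A \<longleftrightarrow>
     (\<forall>(z::complex) (v::complex ^ 'n).
        v \<noteq> 0 \<and> map_matrix complex_of_real A *v v = z *s v \<longrightarrow> Re z < 0)"

definition zero_asymp_stable :: "('n::finite, 'm::finite, 'q::finite, 'p::finite) lti \<Rightarrow> bool" where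
  "zero_asymp_stable S \<longleftrightarrow> hurwitz (mat_A S)"

text \<open>Inputs are merely square integrable, so solutions are understood in the sense of
  Caratheodory, that is, through the integral form of the differential equation.\<close>

definition state_solution ::
  "('n::finite, 'm::finite, 'q::finite, 'p::finite) lti \<Rightarrow> real \<Rightarrow> real ^ 'n \<Rightarrow>
   (real \<Rightarrow> real ^ 'm) \<Rightarrow> (real \<Rightarrow> real ^ 'q) \<Rightarrow> (real \<Rightarrow> real ^ 'n) \<Rightarrow> bool" where
  "state_solution S t0 x0 u d x \<longleftrightarrow>
     continuous_on {t0..} x \<and>
     (\<forall>t\<ge>t0. ((\<lambda>s. mat_A S *v x s + mat_B S *v u s + mat_E S *v d s)
                has_integral (x t - x0)) {t0..t})"

text \<open>For locally integrable \<open>u\<close> and \<open>d\<close> the solution exists and is unique on \<open>{t0..}\<close>,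
  so the description below is proper for every \<open>t \<ge> t0\<close>; the value for \<open>t < t0\<close> is irrelevant.\<close>

definition lti_output ::
  "('n::finite, 'm::finite, 'q::finite, 'p::finite) lti \<Rightarrow> real \<Rightarrow> real ^ 'n \<Rightarrow>
   (real \<Rightarrow> real ^ 'm) \<Rightarrow> (real \<Rightarrow> real ^ 'q) \<Rightarrow> real \<Rightarrow> real ^ 'p" where
  "lti_output S t0 x0 u d t = mat_C S *v (THE \<xi>. \<exists>x. state_solution S t0 x0 u d x \<and> \<xi> = x t)"

section \<open>Square integrable signals\<close>

definition L2 :: "(real \<Rightarrow> real ^ 'k) set" where
  "L2 = {u. u \<in> borel_measurable (lebesgue_on {0..}) \<and>
            (\<lambda>t. (norm (u t))\<^sup>2) absolutely_integrable_on {0..}}"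

definition L2_norm :: "(real \<Rightarrow> real ^ 'k) \<Rightarrow> real" where
  "L2_norm u = sqrt (LINT t:{0..}|lebesgue. (norm (u t))\<^sup>2)"

definition col :: "real ^ 'a \<Rightarrow> real ^ 'b \<Rightarrow> real ^ ('a + 'b)" where
  "col a b = (\<chi> k. case k of Inl i \<Rightarrow> a $ i | Inr j \<Rightarrow> b $ j)"

section \<open>Similarity and series interconnection\<close>

text \<open>The relation is only considered between stable systems, so stability is part of it.
  The requirement that \<open>y - y'\<close> lies in \<open>L2\<close> makes explicit that the left-hand side of the
  inequality is finite: the Bochner integral of a non-integrable function would be \<open>0\<close>.\<close>

definition similar ::
  "real \<Rightarrow> real \<Rightarrow> ('n::finite, 'm::finite, 'q::finite, 'p::finite) lti \<Rightarrow>
   ('k::finite, 'm, 'r::finite, 'p) lti \<Rightarrow> bool" where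
  "similar \<gamma> \<delta> S S' \<longleftrightarrow>
     zero_asymp_stable S \<and> zero_asymp_stable S' \<and>
     (\<exists>\<epsilon>>0. \<exists>\<eta>>0. \<exists>\<mu>>0. \<forall>u\<in>L2. \<forall>u'\<in>L2. \<forall>d\<in>L2. \<exists>d'\<in>L2.
        let y = lti_output S 0 0 u d; y' = lti_output S' 0 0 u' d' in
          (\<lambda>t. y t - y' t) \<in> L2 \<and>
          (L2_norm (\<lambda>t. y t - y' t))\<^sup>2
            \<le> \<gamma> * (L2_norm (\<lambda>t. u t - u' t))\<^sup>2
              + (\<delta> - \<epsilon>) * (L2_norm (\<lambda>t. col (u t) (u' t)))\<^sup>2
              + (\<mu> - \<epsilon>) * (L2_norm d)\<^sup>2 - \<eta> * (L2_norm d')\<^sup>2)"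

definition block_mat ::
  "real ^ 'c ^ 'r \<Rightarrow> real ^ 'd ^ 'r \<Rightarrow> real ^ 'c ^ 's \<Rightarrow> real ^ 'd ^ 's \<Rightarrow>
   real ^ ('c + 'd) ^ ('r + 's)" where
  "block_mat P Q R S = (\<chi> i. case i of Inl a \<Rightarrow> col (P $ a) (Q $ a) | Inr b \<Rightarrow> col (R $ b) (S $ b))"

definition series ::
  "('n1::finite, 'm::finite, 'q1::finite, 'p::finite) lti \<Rightarrow>
   ('n2::finite, 'p, 'q2::finite, 'r::finite) lti \<Rightarrow>
   ('n1 + 'n2, 'm, 'q1 + 'q2, 'r) lti" where
  "series S1 S2 =
     \<lparr> mat_A = block_mat (mat_A S1) 0 (mat_B S2 ** mat_C S1) (mat_A S2),
       mat_B = (\<chi> i. case i of Inl a \<Rightarrow> mat_B S1 $ a | Inr _ \<Rightarrow> 0),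
       mat_E = block_mat (mat_E S1) 0 0 (mat_E S2),
       mat_C = (\<chi> i. col 0 (mat_C S2 $ i)) \<rparr>"

end

theory Submission
  imports Defs "HOL-Computational_Algebra.Fundamental_Theorem_Algebra"
begin

text \<open>Given inputs \<open>u\<close>, \<open>u'\<close> and a disturbance \<open>col d1 d2\<close> of the series interconnection, let \<open>y1\<close> be
  the output of the first system. The first similarity supplies \<open>d1'\<close>, hence the output \<open>y1'\<close> of
  the first primed system. Applied to the inputs \<open>y1\<close>, \<open>y1'\<close> and the disturbance \<open>d2\<close>, the second
  similarity supplies \<open>d2'\<close>, and \<open>col d1' d2'\<close> is the required disturbance. The second inequality
  bounds the output difference by the energies of \<open>y1 - y1'\<close>, \<open>y1\<close>, \<open>y1'\<close>, \<open>d2\<close> and \<open>d2'\<close>. Here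
  \<open>energy y1' \<le> 2 * energy y1 + 2 * energy (y1 - y1')\<close>, the first inequality bounds
  \<open>energy (y1 - y1')\<close>, and \<open>energy y1 \<le> g * (energy u + energy d1)\<close>. Choosing the constants of the
  series interconnection large enough finishes the estimate; the weight of \<open>energy (y1 - y1')\<close> is
  positive, so the negative term in \<open>d1'\<close> persists.

  The analytic part is that a Hurwitz system has a finite \<open>L2\<close> gain \<open>g\<close>, and that its solutions
  exist and are unique, so that the output really is given by the definite description
  (\<open>stable_output_bound\<close>, \<open>state_solution_unique\<close>). Existence and the gain are obtained together,
  without the matrix exponential (\<open>hurwitz_L2_stable\<close>). For \<open>Re z < 0\<close> the scalar equation
  \<open>r' = z r + f\<close> has an explicit solution with energy at most \<open>energy f / (Re z)\<^sup>2\<close>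
  (\<open>convolve_exp_decay\<close>). If \<open>r' = z r + w\<close> and \<open>y' = A y + (A - z) N r\<close>, then \<open>x = y + N r\<close> solves
  \<open>x' = A x + N w\<close>. So \<open>x' = A x + q(A) w\<close> can be solved with finite gain whenever this holds for
  \<open>p = (X - z) q\<close> in place of \<open>q\<close> (\<open>stably_solvable_linear_factor\<close>). Starting from an annihilating
  polynomial of \<open>A\<close> of least degree, for which the zero solution works and whose roots are
  eigenvalues, all factors can be cancelled.\<close>

section \<open>Square integrable signals\<close>

text \<open>Square integrability on \<open>[0, \<infinity>)\<close> for signals with values in any Euclidean space, so that
  complex signals are covered as well. The energy is the squared \<open>L2\<close> norm. Since the integrand
  is nonnegative, the gauge integral used here agrees with the Lebesgue integral.\<close>
definition sq_integrable :: "(real \<Rightarrow> 'a::euclidean_space) \<Rightarrow> bool" where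
  "sq_integrable f \<longleftrightarrow>
     f \<in> borel_measurable (lebesgue_on {0..}) \<and> (\<lambda>t. (norm (f t))\<^sup>2) integrable_on {0..}"

definition energy :: "(real \<Rightarrow> 'a::euclidean_space) \<Rightarrow> real" where
  "energy f = integral {0..} (\<lambda>t. (norm (f t))\<^sup>2)"

lemma L2_iff_sq_integrable: "u \<in> L2 \<longleftrightarrow> sq_integrable u"
  by (simp add: L2_def sq_integrable_def absolutely_integrable_on_iff_nonneg)

lemma L2_norm_power2:
  assumes "sq_integrable u"
  shows "(L2_norm u)\<^sup>2 = energy u"
proof -
  have "(LINT t:{0..}|lebesgue. (norm (u t))\<^sup>2) = energy u"
    unfolding energy_def using assms
    by (intro set_lebesgue_integral_eq_integral)
      (simp add: sq_integrable_def absolutely_integrable_on_iff_nonneg)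
  moreover have "energy u \<ge> 0"
    using assms by (auto simp: energy_def sq_integrable_def intro!: integral_nonneg)
  ultimately show ?thesis by (simp add: L2_norm_def)
qed

lemma energy_nonneg: "sq_integrable f \<Longrightarrow> energy f \<ge> 0"
  by (auto simp: energy_def sq_integrable_def intro!: integral_nonneg)

lemma sq_integrable_bound:
  assumes "f \<in> borel_measurable (lebesgue_on {0..})" "sq_integrable g" "sq_integrable h"
    and "a \<ge> 0" "b \<ge> 0"
    and "\<And>t. t \<ge> 0 \<Longrightarrow> (norm (f t))\<^sup>2 \<le> a * (norm (g t))\<^sup>2 + b * (norm (h t))\<^sup>2"
  shows "sq_integrable f" and "energy f \<le> a * energy g + b * energy h"
proof -
  have g: "(\<lambda>t. a * (norm (g t))\<^sup>2) integrable_on {0..}" and h: "(\<lambda>t. b * (norm (h t))\<^sup>2) integrable_on {0..}"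
    using assms unfolding sq_integrable_def by (auto intro: integrable_on_mult_right)
  have "(\<lambda>t. (norm (f t))\<^sup>2) integrable_on {0..}"
    by (rule measurable_bounded_by_integrable_imp_integrable_real[OF _ integrable_add[OF g h]])
      (use assms in auto)
  then show "sq_integrable f" using assms by (simp add: sq_integrable_def)
  have "energy f \<le> integral {0..} (\<lambda>t. a * (norm (g t))\<^sup>2 + b * (norm (h t))\<^sup>2)"
    unfolding energy_def
    by (rule integral_le[OF _ integrable_add[OF g h]]) (use assms \<open>sq_integrable f\<close> in \<open>auto simp: sq_integrable_def\<close>)
  also have "\<dots> = a * energy g + b * energy h"
    by (simp add: integral_add[OF g h] energy_def)
  finally show "energy f \<le> a * energy g + b * energy h" .
qed

lemma norm_add_power2_le: "(norm (a + b))\<^sup>2 \<le> 2 * (norm a)\<^sup>2 + 2 * (norm (b::'a::real_inner))\<^sup>2"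
proof -
  have "0 \<le> (norm (a - b))\<^sup>2" by simp
  then show ?thesis by (simp add: power2_norm_eq_inner inner_simps inner_commute)
qed

lemma sq_integrable_add:
  assumes "sq_integrable f" "sq_integrable g"
  shows "sq_integrable (\<lambda>t. f t + g t)" and "energy (\<lambda>t. f t + g t) \<le> 2 * energy f + 2 * energy g"
proof -
  have m: "(\<lambda>t. f t + g t) \<in> borel_measurable (lebesgue_on {0..})"
    using assms by (auto simp: sq_integrable_def)
  show "sq_integrable (\<lambda>t. f t + g t)" "energy (\<lambda>t. f t + g t) \<le> 2 * energy f + 2 * energy g"
    by (rule sq_integrable_bound[OF m assms, of 2 2]; simp add: norm_add_power2_le)+
qed

lemma sq_integrable_diff:
  assumes "sq_integrable f" "sq_integrable g"
  shows "sq_integrable (\<lambda>t. f t - g t)" and "energy (\<lambda>t. f t - g t) \<le> 2 * energy f + 2 * energy g"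
proof -
  have m: "(\<lambda>t. f t - g t) \<in> borel_measurable (lebesgue_on {0..})"
    using assms by (auto simp: sq_integrable_def)
  have *: "(norm (f t - g t))\<^sup>2 \<le> 2 * (norm (f t))\<^sup>2 + 2 * (norm (g t))\<^sup>2" for t
    using norm_add_power2_le[of "f t" "- g t"] by simp
  show "sq_integrable (\<lambda>t. f t - g t)" "energy (\<lambda>t. f t - g t) \<le> 2 * energy f + 2 * energy g"
    by (rule sq_integrable_bound[OF m assms, of 2 2]; simp add: *)+
qed

lemma borel_measurable_bounded_linear:
  assumes "bounded_linear T" "f \<in> borel_measurable M"
  shows "(\<lambda>t. T (f t)) \<in> borel_measurable M"
  using measurable_compose[OF assms(2) borel_measurable_continuous_onI[OF bounded_linear.continuous_on[OF assms(1) continuous_on_id]]]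
  by simp

text \<open>The gain \<open>K\<close> depends on the linear map only, not on the signal.\<close>
lemma sq_integrable_linear:
  assumes "linear T"
  obtains K where "K \<ge> 0" "\<And>f. sq_integrable f \<Longrightarrow> sq_integrable (\<lambda>t. T (f t))"
    "\<And>f. sq_integrable f \<Longrightarrow> energy (\<lambda>t. T (f t)) \<le> K * energy f"
proof -
  have bl: "bounded_linear T" using assms by (simp add: linear_conv_bounded_linear)
  from bounded_linear.bounded[OF bl] obtain k where k: "\<And>x. norm (T x) \<le> norm x * k" by blast
  have k2: "(norm (T x))\<^sup>2 \<le> k\<^sup>2 * (norm x)\<^sup>2 + 0 * (norm x)\<^sup>2" for x
    using power_mono[OF k, of x 2] by (simp add: power_mult_distrib mult.commute)
  have meas: "(\<lambda>t. T (f t)) \<in> borel_measurable (lebesgue_on {0..})" if "sq_integrable f" for f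
    using that borel_measurable_bounded_linear[OF bl] by (auto simp: sq_integrable_def)
  show ?thesis
  proof (rule that[of "k\<^sup>2"])
    fix f :: "real \<Rightarrow> 'a" assume f: "sq_integrable f"
    show "sq_integrable (\<lambda>t. T (f t))"
      by (rule sq_integrable_bound(1)[OF meas f f, where a = "k\<^sup>2" and b = 0]) (use f k2 in auto)
    show "energy (\<lambda>t. T (f t)) \<le> k\<^sup>2 * energy f"
      using sq_integrable_bound(2)[OF meas f f, where a = "k\<^sup>2" and b = 0] f k2 by simp
  qed simp
qed

lemma sq_integrable_cong:
  assumes "\<And>t. t \<ge> 0 \<Longrightarrow> f t = g t"
  shows "sq_integrable f \<longleftrightarrow> sq_integrable g" and "energy f = energy g"
proof -
  have "f \<in> borel_measurable (lebesgue_on {0..}) \<longleftrightarrow> g \<in> borel_measurable (lebesgue_on {0..})"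
    using assms by (intro measurable_cong) auto
  moreover have "(\<lambda>t. (norm (f t))\<^sup>2) integrable_on {0..} \<longleftrightarrow> (\<lambda>t. (norm (g t))\<^sup>2) integrable_on {0..}"
    using assms by (intro integrable_cong) auto
  ultimately show "sq_integrable f \<longleftrightarrow> sq_integrable g" by (simp add: sq_integrable_def)
  show "energy f = energy g" unfolding energy_def using assms by (intro integral_cong) auto
qed

lemma sq_integrable_imp_absolutely_integrable:
  assumes "sq_integrable f"
  shows "f absolutely_integrable_on {0..t}" and "(\<lambda>t. (norm (f t))\<^sup>2) absolutely_integrable_on {0..t}"
proof -
  have i: "(\<lambda>t. (norm (f t))\<^sup>2) integrable_on {0..t}"
    using assms integrable_on_subinterval[of _ "{0..}" 0 t] by (force simp: sq_integrable_def)
  then show "(\<lambda>t. (norm (f t))\<^sup>2) absolutely_integrable_on {0..t}"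
    by (simp add: absolutely_integrable_on_iff_nonneg)
  have m: "f \<in> borel_measurable (lebesgue_on {0..t})"
    by (rule measurable_restrict_mono[of f lebesgue "{0..}"])
      (use assms in \<open>auto simp only: sq_integrable_def atLeastAtMost_iff atLeast_iff subset_iff\<close>)
  show "f absolutely_integrable_on {0..t}"
  proof (rule measurable_bounded_by_integrable_imp_absolutely_integrable[OF m])
    show "(\<lambda>t. 1 + (norm (f t))\<^sup>2) integrable_on {0..t}"
      by (intro integrable_add i) auto
    show "norm (f x) \<le> 1 + (norm (f x))\<^sup>2" for x
    proof -
      have "2 * norm (f x) \<le> (norm (f x))\<^sup>2 + 1"
        using zero_le_power2[of "norm (f x) - 1"] by (simp add: power2_diff)
      then show ?thesis using norm_ge_zero[of "f x"] by linarith
    qed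
  qed auto
qed

lemma continuous_on_atLeastI:
  fixes f :: "real \<Rightarrow> 'a::topological_space"
  assumes "\<And>T. continuous_on {a..T} f"
  shows "continuous_on {a..} f"
  unfolding continuous_on_eq_continuous_within
proof
  fix t assume t: "t \<in> {a..}"
  have "at t within {a..} = at t within {a..t + 1}"
    by (rule at_within_nhd[of t "{..<t + 1}"]) auto
  then show "continuous (at t within {a..}) f"
    using assms[of "t + 1"] t by (simp add: continuous_on_eq_continuous_within)
qed

text \<open>A uniform bound on the energy over all finite horizons bounds the total energy, by monotone
  convergence.\<close>
lemma sq_integrable_continuousI:
  fixes r :: "real \<Rightarrow> 'a::euclidean_space"
  assumes "continuous_on {0..} r"
    and "\<And>T. T \<ge> 0 \<Longrightarrow> integral {0..T} (\<lambda>t. (norm (r t))\<^sup>2) \<le> B"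
  shows "sq_integrable r" and "energy r \<le> B"
proof -
  let ?h = "\<lambda>t. (norm (r t))\<^sup>2" and ?I = "\<lambda>T. integral {0..T} (\<lambda>t. (norm (r t))\<^sup>2)"
  have cont: "continuous_on {0..T} ?h" for T
    by (intro continuous_intros continuous_on_subset[OF assms(1)]) auto
  have int: "?h integrable_on {0..T}" for T
    by (rule integrable_continuous_real[OF cont])
  have mono: "incseq (\<lambda>n. ?I (real n))"
    by (intro incseq_SucI integral_subset_le int) auto
  have mono': "monotone (\<le>) (\<le>) ?I"
    by (intro monotoneI integral_subset_le int) auto
  have bdd: "?I (real n) \<le> B" for n
    by (rule assms(2)) simp
  obtain L where L: "(\<lambda>n. ?I (real n)) \<longlonglongrightarrow> L"
    using incseq_convergent[OF mono] bdd by blast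
  have hi: "(?h has_integral L) {0..}"
    by (rule has_integral_to_inf[OF int tendsto_at_topI_sequentially_real[OF mono' L]]) auto
  have "r \<in> borel_measurable (lebesgue_on {0..})"
    by (rule continuous_imp_measurable_on_sets_lebesgue[OF assms(1)]) auto
  then show "sq_integrable r" using hi by (auto simp: sq_integrable_def)
  have "L \<le> B" by (rule LIMSEQ_le_const2[OF L]) (use bdd in auto)
  then show "energy r \<le> B" using hi by (simp add: energy_def integral_unique)
qed

lemma has_integral_vec_iff:
  fixes f :: "'b::euclidean_space \<Rightarrow> 'a::euclidean_space ^ 'n"
  shows "(f has_integral I) S \<longleftrightarrow> (\<forall>i. ((\<lambda>x. f x $ i) has_integral I $ i) S)"
proof -
  have "(f has_integral I) S \<longleftrightarrow> (\<forall>i. \<forall>u\<in>Basis. ((\<lambda>x. f x $ i \<bullet> u) has_integral I $ i \<bullet> u) S)"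
    by (subst has_integral_componentwise_iff) (auto simp: Basis_vec_def inner_axis)
  then show ?thesis by (subst has_integral_componentwise_iff) simp
qed

lemma norm_vec_power2: "(norm x)\<^sup>2 = (\<Sum>i\<in>UNIV. (norm (x $ i))\<^sup>2)"
  by (simp add: norm_vec_def L2_set_def sum_nonneg)

lemma sq_integrable_vecI:
  fixes f :: "real \<Rightarrow> 'a::euclidean_space ^ 'n"
  assumes "\<And>i. sq_integrable (\<lambda>t. f t $ i)"
  shows "sq_integrable f" and "energy f = (\<Sum>i\<in>UNIV. energy (\<lambda>t. f t $ i))"
proof -
  have "f \<in> borel_measurable (lebesgue_on {0..})"
    using assms
    by (auto simp: borel_measurable_euclidean_space[of f] Basis_vec_def inner_axis sq_integrable_def
        intro: borel_measurable_bounded_linear[OF bounded_linear_inner_left])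
  moreover have "((\<lambda>t. (norm (f t))\<^sup>2) has_integral (\<Sum>i\<in>UNIV. energy (\<lambda>t. f t $ i))) {0..}"
    unfolding norm_vec_power2 energy_def
    by (intro has_integral_sum) (use assms in \<open>auto simp: sq_integrable_def\<close>)
  ultimately show "sq_integrable f" "energy f = (\<Sum>i\<in>UNIV. energy (\<lambda>t. f t $ i))"
    by (auto simp: sq_integrable_def energy_def integral_unique)
qed

lemma sq_integrable_vecD:
  assumes "sq_integrable f"
  shows "sq_integrable (\<lambda>t. f t $ i)"
  using sq_integrable_linear[of "\<lambda>x. x $ i"] assms
  by (metis bounded_linear_vec_nth linear_conv_bounded_linear)

section \<open>The scalar linear equation\<close>

lemma absolutely_integrable_mult_continuous:
  fixes h f :: "real \<Rightarrow> 'a::{real_normed_field,euclidean_space}"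
  assumes "continuous_on {a..b} h" "f absolutely_integrable_on {a..b}"
  shows "(\<lambda>s. h s * f s) absolutely_integrable_on {a..b}"
proof (rule absolutely_integrable_bounded_measurable_product[where h = "(*)", OF _ _ _ _ assms(2)])
  show "bilinear ((*) :: 'a \<Rightarrow> 'a \<Rightarrow> 'a)"
    using bounded_bilinear_mult by (simp add: bilinear_conv_bounded_bilinear)
  show "h \<in> borel_measurable (lebesgue_on {a..b})"
    by (rule continuous_imp_measurable_on_sets_lebesgue[OF assms(1)]) auto
  show "bounded (h ` {a..b})"
    using assms(1) by (simp add: compact_imp_bounded compact_continuous_image)
qed auto

text \<open>The product rule for a continuously differentiable \<open>H\<close> and the indefinite integral \<open>G\<close> of a
  merely absolutely integrable \<open>g\<close>; \<open>G\<close> need not be differentiable everywhere. The defect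
  \<open>D t = H t * G t - integral {0..t} (H' * G + H * g)\<close> satisfies
  \<open>norm (D t - D s) \<le> 2 * C * (t - s) * (\<Gamma> t - \<Gamma> s)\<close> for \<open>s \<le> t\<close>, where \<open>C\<close> bounds \<open>H'\<close> and \<open>\<Gamma>\<close> is the
  indefinite integral of \<open>norm g\<close>. As \<open>\<Gamma>\<close> is continuous, the derivative of \<open>D\<close> vanishes
  everywhere.\<close>
lemma product_rule_indefinite_integral:
  fixes H H' g :: "real \<Rightarrow> 'a::{real_normed_field,euclidean_space}"
  assumes T: "0 \<le> T"
    and H: "\<And>t. t \<in> {0..T} \<Longrightarrow> (H has_vector_derivative H' t) (at t within {0..T})"
    and H': "continuous_on {0..T} H'"
    and g: "g absolutely_integrable_on {0..T}"
  shows "((\<lambda>s. H' s * integral {0..s} g + H s * g s) has_integral H T * integral {0..T} g) {0..T}"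
proof -
  define G where "G t = integral {0..t} g" for t
  define \<Gamma> where "\<Gamma> t = integral {0..t} (\<lambda>s. norm (g s))" for t
  have gi: "g integrable_on {0..T}" and ngi: "(\<lambda>s. norm (g s)) integrable_on {0..T}"
    using g by (auto simp: absolutely_integrable_on_def)
  have contG: "continuous_on {0..T} G" and cont\<Gamma>: "continuous_on {0..T} \<Gamma>"
    unfolding G_def \<Gamma>_def by (intro indefinite_integral_continuous_1 gi ngi)+
  have contH: "continuous_on {0..T} H"
    by (rule continuous_on_vector_derivative) (use H in auto)
  have gis: "g integrable_on {s..t}" and ngis: "(\<lambda>s. norm (g s)) integrable_on {s..t}"
    if "0 \<le> s" "t \<le> T" for s t
    using that by (auto intro: integrable_on_subinterval[OF gi] integrable_on_subinterval[OF ngi])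
  have Gd: "integral {s..t} g = G t - G s" "integral {s..t} (\<lambda>s. norm (g s)) = \<Gamma> t - \<Gamma> s"
    if "0 \<le> s" "s \<le> t" "t \<le> T" for s t
    using Henstock_Kurzweil_Integration.integral_combine[OF that(1,2) gis[of 0 t]]
      Henstock_Kurzweil_Integration.integral_combine[OF that(1,2) ngis[of 0 t]] that
    by (auto simp: G_def \<Gamma>_def algebra_simps)
  have \<Gamma>mono: "\<Gamma> s \<le> \<Gamma> t" if "0 \<le> s" "s \<le> t" "t \<le> T" for s t
  proof -
    have "0 \<le> integral {s..t} (\<lambda>s. norm (g s))" by (intro integral_nonneg ngis) (use that in auto)
    then show ?thesis using Gd(2)[OF that] by simp
  qed
  have G\<Gamma>: "norm (G t - G s) \<le> \<Gamma> t - \<Gamma> s" if "0 \<le> s" "s \<le> t" "t \<le> T" for s t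
    unfolding Gd[OF that, symmetric]
    by (rule integral_norm_bound_integral) (use gis ngis that in auto)
  define F where "F s = H' s * G s + H s * g s" for s
  have F1: "(\<lambda>s. H' s * G s) integrable_on {0..T}"
    by (intro integrable_continuous_real continuous_intros H' contG)
  have F2: "(\<lambda>s. H s * g s) integrable_on {0..T}"
    using absolutely_integrable_mult_continuous[OF contH g] by (simp add: absolutely_integrable_on_def)
  have Fi: "F integrable_on {0..T}"
    unfolding F_def by (rule integrable_add[OF F1 F2])
  define D where "D t = H t * G t - integral {0..t} F" for t
  obtain C where C: "C > 0" "\<And>t. t \<in> {0..T} \<Longrightarrow> norm (H' t) \<le> C"
    using compact_imp_bounded[OF compact_continuous_image[OF H']] by (auto simp: bounded_pos)
  have Hd: "norm (H r - H s) \<le> C * (r - s)" if "0 \<le> s" "s \<le> r" "r \<le> T" for s r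
  proof -
    have "norm (H r - H s) \<le> C * norm (r - s)"
    proof (rule differentiable_bound[of "{0..T}" H "\<lambda>t h. h *\<^sub>R H' t"])
      show "(H has_derivative (\<lambda>h. h *\<^sub>R H' x)) (at x within {0..T})" if "x \<in> {0..T}" for x
        using H[OF that] by (simp add: has_vector_derivative_def)
      show "onorm (\<lambda>h. h *\<^sub>R H' x) \<le> C" if "x \<in> {0..T}" for x
      proof (rule onorm_bound)
        show "norm (h *\<^sub>R H' x) \<le> C * norm h" for h
          using mult_right_mono[OF C(2)[OF that] abs_ge_zero[of h]] by (simp add: mult.commute)
      qed (use C in simp)
    qed (use that in auto)
    then show ?thesis using that by simp
  qed
  have Dest: "norm (D t - D s) \<le> 2 * C * (t - s) * (\<Gamma> t - \<Gamma> s)" if st: "0 \<le> s" "s \<le> t" "t \<le> T" for s t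
  proof -
    have sub: "{s..t} \<subseteq> {0..T}" using st by auto
    have i1: "(H' has_integral (H t - H s)) {s..t}"
      by (rule fundamental_theorem_of_calculus[OF st(2)])
        (use sub in \<open>auto intro: has_vector_derivative_within_subset[OF H]\<close>)
    have i2: "(g has_integral (G t - G s)) {s..t}"
      using gis[of s t] Gd[OF st] st by (auto simp: has_integral_iff)
    have i3: "(F has_integral (integral {0..t} F - integral {0..s} F)) {s..t}"
      using Henstock_Kurzweil_Integration.integral_combine[of 0 s t F] st
        integrable_on_subinterval[OF Fi, of 0 t] integrable_on_subinterval[OF Fi, of s t]
      by (auto simp: has_integral_iff algebra_simps)
    have "((\<lambda>r. H' r * G t + H s * g r - F r) has_integral
           ((H t - H s) * G t + H s * (G t - G s) - (integral {0..t} F - integral {0..s} F))) {s..t}"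
      by (intro has_integral_diff has_integral_add has_integral_mult_left has_integral_mult_right i1 i2 i3)
    moreover have "(H t - H s) * G t + H s * (G t - G s) - (integral {0..t} F - integral {0..s} F) = D t - D s"
      by (simp add: D_def algebra_simps)
    moreover have "(\<lambda>r. H' r * G t + H s * g r - F r) = (\<lambda>r. H' r * (G t - G r) + (H s - H r) * g r)"
      by (simp add: F_def algebra_simps fun_eq_iff)
    ultimately have i4: "((\<lambda>r. H' r * (G t - G r) + (H s - H r) * g r) has_integral (D t - D s)) {s..t}"
      by simp
    have i5: "((\<lambda>r. C * (\<Gamma> t - \<Gamma> s) + C * (t - s) * norm (g r)) has_integral
          (C * (\<Gamma> t - \<Gamma> s) * (t - s) + C * (t - s) * (\<Gamma> t - \<Gamma> s))) {s..t}"
      using ngis[of s t] Gd[OF st] st has_integral_const_real[of "C * (\<Gamma> t - \<Gamma> s)" s t]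
      by (intro has_integral_add has_integral_mult_right) (auto simp: has_integral_iff mult.commute)
    have "norm (integral {s..t} (\<lambda>r. H' r * (G t - G r) + (H s - H r) * g r)) \<le>
         integral {s..t} (\<lambda>r. C * (\<Gamma> t - \<Gamma> s) + C * (t - s) * norm (g r))"
    proof (rule integral_norm_bound_integral)
      fix r assume r: "r \<in> {s..t}"
      have "norm (H' r * (G t - G r)) \<le> C * (\<Gamma> t - \<Gamma> s)"
        unfolding norm_mult
        by (rule mult_mono) (use C r st G\<Gamma>[of r t] \<Gamma>mono[of s r] in auto)
      moreover have "norm ((H s - H r) * g r) \<le> C * (t - s) * norm (g r)"
      proof -
        have "norm (H s - H r) \<le> C * (r - s)" using Hd[of s r] r st by (simp add: norm_minus_commute)
        also have "\<dots> \<le> C * (t - s)" using r C by auto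
        finally show ?thesis unfolding norm_mult by (rule mult_right_mono) auto
      qed
      ultimately show "norm (H' r * (G t - G r) + (H s - H r) * g r) \<le> C * (\<Gamma> t - \<Gamma> s) + C * (t - s) * norm (g r)"
        by (rule norm_triangle_mono)
    qed (use i4 i5 in auto)
    then show ?thesis using i4 i5 by (simp add: integral_unique algebra_simps)
  qed
  have "(D has_derivative (\<lambda>h. 0)) (at t within {0..T})" if t: "t \<in> {0..T}" for t
    unfolding has_derivative_within
  proof (intro conjI)
    have "((\<lambda>s. 2 * C * \<bar>\<Gamma> s - \<Gamma> t\<bar>) \<longlongrightarrow> 2 * C * \<bar>\<Gamma> t - \<Gamma> t\<bar>) (at t within {0..T})"
      using cont\<Gamma> t by (intro tendsto_intros) (auto simp: continuous_on_def)
    then have lim: "((\<lambda>s. 2 * C * \<bar>\<Gamma> s - \<Gamma> t\<bar>) \<longlongrightarrow> 0) (at t within {0..T})" by simp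
    have "norm ((1 / norm (s - t)) *\<^sub>R (D s - (D t + 0))) \<le> 2 * C * \<bar>\<Gamma> s - \<Gamma> t\<bar>"
      if "s \<in> {0..T}" "s \<noteq> t" for s
    proof -
      have "norm (D s - D t) \<le> 2 * C * \<bar>s - t\<bar> * \<bar>\<Gamma> s - \<Gamma> t\<bar>"
      proof (cases "s \<le> t")
        case True
        then show ?thesis using Dest[of s t] that t \<Gamma>mono[of s t] by (auto simp: norm_minus_commute)
      next
        case False
        then show ?thesis using Dest[of t s] that t \<Gamma>mono[of t s] by auto
      qed
      then show ?thesis using that by (simp add: divide_simps mult_ac)
    qed
    then show "((\<lambda>s. (1 / norm (s - t)) *\<^sub>R (D s - (D t + 0))) \<longlongrightarrow> 0) (at t within {0..T})"
      by (intro Lim_null_comparison[OF _ lim]) (auto simp: eventually_at_filter)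
  qed simp
  then obtain c where c: "\<And>t. t \<in> {0..T} \<Longrightarrow> D t = c"
    using has_derivative_zero_constant[of "{0..T}" D] by auto
  have "D T = D 0" using c[of T] c[of 0] T by simp
  then have "integral {0..T} F = H T * G T" by (simp add: D_def G_def)
  then have "(F has_integral H T * G T) {0..T}" using Fi by (metis integrable_integral)
  then show ?thesis by (simp add: F_def[abs_def] G_def)
qed

text \<open>The solution \<open>r t = integral {0..t} (\<lambda>s. exp (z * (t - s)) * f s)\<close> of \<open>r' = z r + f\<close>,
  \<open>r 0 = 0\<close>, with the factor \<open>exp (t * z)\<close> moved out of the integral.\<close>
definition convolve_exp :: "'a::{real_normed_field,euclidean_space} \<Rightarrow> (real \<Rightarrow> 'a) \<Rightarrow> real \<Rightarrow> 'a" where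
  "convolve_exp z f t = exp (t *\<^sub>R z) * integral {0..t} (\<lambda>s. exp (- s *\<^sub>R z) * f s)"

lemma
  fixes f :: "real \<Rightarrow> 'a::{real_normed_field,euclidean_space}"
  assumes f: "\<And>T. f absolutely_integrable_on {0..T}"
  shows convolve_exp_integral_equation:
      "T \<ge> 0 \<Longrightarrow> ((\<lambda>s. z * convolve_exp z f s + f s) has_integral convolve_exp z f T) {0..T}"
    and continuous_on_convolve_exp: "continuous_on {0..} (convolve_exp z f)"
proof -
  have fe: "(\<lambda>s. exp (- s *\<^sub>R z) * f s) absolutely_integrable_on {0..T}" for T
    by (intro absolutely_integrable_mult_continuous f continuous_intros)
  show "((\<lambda>s. z * convolve_exp z f s + f s) has_integral convolve_exp z f T) {0..T}" if "T \<ge> 0"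
  proof -
    have "((\<lambda>t. exp (t *\<^sub>R z)) has_vector_derivative z * exp (t *\<^sub>R z)) (at t within {0..T})" for t
      using exp_scaleR_has_vector_derivative_right[of z t] by (simp add: mult.commute)
    note * = product_rule_indefinite_integral[OF that this _ fe]
    have e: "exp (s *\<^sub>R z) * exp (- s *\<^sub>R z) = 1" for s
      by (simp add: exp_minus_inverse)
    have "((\<lambda>s. z * exp (s *\<^sub>R z) * integral {0..s} (\<lambda>s. exp (- s *\<^sub>R z) * f s) + exp (s *\<^sub>R z) * (exp (- s *\<^sub>R z) * f s))
        has_integral convolve_exp z f T) {0..T}"
      unfolding convolve_exp_def by (rule *) (intro continuous_intros)
    then show ?thesis
      by (simp only: convolve_exp_def mult.assoc[symmetric] e mult_1_left)
  qed
  have "continuous_on {0..T} (convolve_exp z f)" for T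
    unfolding convolve_exp_def using fe[of T]
    by (intro continuous_intros indefinite_integral_continuous_1) (auto simp: absolutely_integrable_on_def)
  then show "continuous_on {0..} (convolve_exp z f)"
    by (rule continuous_on_atLeastI)
qed

text \<open>Put \<open>a = - Re z\<close>. Then \<open>norm (r t)\<close> is at most the convolution \<open>m t\<close> of \<open>norm f\<close> with
  \<open>exp (- a * t)\<close>, and \<open>(m t)\<^sup>2 \<le> \<rho> t / a\<close>, where \<open>\<rho>\<close> is the convolution of \<open>(norm f)\<^sup>2\<close> with the
  same kernel. Integrating \<open>\<rho>' = - a \<rho> + (norm f)\<^sup>2\<close> gives \<open>integral {0..T} \<rho> \<le> energy f / a\<close>.\<close>
lemma convolve_exp_decay:
  fixes z :: complex and f :: "real \<Rightarrow> complex"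
  assumes z: "Re z < 0" and f: "sq_integrable f"
  shows "sq_integrable (convolve_exp z f)" and "energy (convolve_exp z f) \<le> energy f / (Re z)\<^sup>2"
proof -
  define a where "a = - Re z"
  have a: "a > 0" using z by (simp add: a_def)
  note fi = sq_integrable_imp_absolutely_integrable(1)[OF f]
  note f2i = sq_integrable_imp_absolutely_integrable(2)[OF f]
  have nfi: "(\<lambda>t. norm (f t)) absolutely_integrable_on {0..T}" for T
    using fi[of T] by (rule absolutely_integrable_norm[unfolded o_def])
  define \<rho> where "\<rho> = convolve_exp (- a) (\<lambda>t. (norm (f t))\<^sup>2)"
  define m where "m = convolve_exp (- a) (\<lambda>t. norm (f t))"
  note \<rho> = convolve_exp_integral_equation[OF f2i, of _ "- a", folded \<rho>_def]
  have cont\<rho>: "continuous_on {0..} \<rho>"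
    unfolding \<rho>_def by (rule continuous_on_convolve_exp[OF f2i])
  have contr: "continuous_on {0..} (convolve_exp z f)"
    by (rule continuous_on_convolve_exp[OF fi])
  have e1: "(\<lambda>s. exp (a * s) * norm (f s)) integrable_on {0..t}"
    and e2: "(\<lambda>s. exp (a * s) * (norm (f s))\<^sup>2) integrable_on {0..t}"
    and e3: "(\<lambda>s. exp (- s *\<^sub>R z) * f s) integrable_on {0..t}" for t
    by (intro set_lebesgue_integral_eq_integral(1) absolutely_integrable_mult_continuous
        nfi f2i fi continuous_intros)+
  have m_eq: "m t = exp (- (a * t)) * integral {0..t} (\<lambda>s. exp (a * s) * norm (f s))" for t
    by (simp add: m_def convolve_exp_def mult.commute)
  have \<rho>_eq: "\<rho> t = exp (- (a * t)) * integral {0..t} (\<lambda>s. exp (a * s) * (norm (f s))\<^sup>2)" for t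
    by (simp add: \<rho>_def convolve_exp_def mult.commute)
  have \<rho>_nonneg: "\<rho> t \<ge> 0" for t
    unfolding \<rho>_eq by (intro mult_nonneg_nonneg integral_nonneg e2) auto
  have m_nonneg: "m t \<ge> 0" for t
    unfolding m_eq by (intro mult_nonneg_nonneg integral_nonneg e1) auto
  have rm: "norm (convolve_exp z f t) \<le> m t" for t
  proof -
    have "norm (integral {0..t} (\<lambda>s. exp (- s *\<^sub>R z) * f s)) \<le> integral {0..t} (\<lambda>s. exp (a * s) * norm (f s))"
      by (rule integral_norm_bound_integral[OF e3 e1]) (simp add: norm_mult a_def mult.commute)
    then show ?thesis
      unfolding convolve_exp_def m_eq norm_mult
      by (intro mult_mono) (auto simp: a_def mult.commute)
  qed
  have m\<rho>: "(m t)\<^sup>2 \<le> \<rho> t / a" if t: "t \<ge> 0" for t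
  proof (cases "m t = 0")
    case False
    then have mpos: "m t > 0" using m_nonneg[of t] by simp
    \<comment> \<open>The weight \<open>l\<close> is tuned so that the first term of the Young inequality contributes
      exactly half of \<open>m t\<close>.\<close>
    define l where "l = a * m t"
    have l: "l > 0" using a mpos by (simp add: l_def)
    have ptw: "norm (f s) \<le> l / 2 + (norm (f s))\<^sup>2 / (2 * l)" for s
    proof -
      have "0 \<le> (norm (f s) - l)\<^sup>2" by simp
      then show ?thesis using l by (simp add: field_simps power2_eq_square)
    qed
    have ie: "((\<lambda>s. exp (a * s)) has_integral (exp (a * t) / a - 1 / a)) {0..t}"
    proof -
      have "((\<lambda>s. exp (a * s)) has_integral (exp (a * t) / a - exp (a * 0) / a)) {0..t}"
        by (rule fundamental_theorem_of_calculus[OF t])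
          (use a in \<open>auto intro!: derivative_eq_intros simp: has_real_derivative_iff_has_vector_derivative[symmetric]\<close>)
      then show ?thesis by simp
    qed
    have "integral {0..t} (\<lambda>s. exp (a * s) * norm (f s))
        \<le> integral {0..t} (\<lambda>s. exp (a * s) * (l / 2) + (exp (a * s) * (norm (f s))\<^sup>2) / (2 * l))"
    proof (rule integral_le[OF e1])
      show "exp (a * s) * norm (f s) \<le> exp (a * s) * (l / 2) + exp (a * s) * (norm (f s))\<^sup>2 / (2 * l)" for s
        using mult_left_mono[OF ptw[of s], of "exp (a * s)"] by (simp add: distrib_left)
      show "(\<lambda>s. exp (a * s) * (l / 2) + (exp (a * s) * (norm (f s))\<^sup>2) / (2 * l)) integrable_on {0..t}"
        using ie e2 by (intro integrable_add integrable_on_mult_left integrable_on_divide) auto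
    qed
    also have "\<dots> = (exp (a * t) / a - 1 / a) * (l / 2) + integral {0..t} (\<lambda>s. exp (a * s) * (norm (f s))\<^sup>2) / (2 * l)"
      by (intro integral_unique has_integral_add has_integral_mult_left has_integral_divide ie)
        (use e2 in \<open>auto simp: has_integral_iff\<close>)
    also have "\<dots> \<le> (exp (a * t) / a) * (l / 2) + integral {0..t} (\<lambda>s. exp (a * s) * (norm (f s))\<^sup>2) / (2 * l)"
      using a l by (intro add_right_mono mult_right_mono) auto
    finally have "m t \<le> exp (- (a * t)) * ((exp (a * t) / a) * (l / 2) + integral {0..t} (\<lambda>s. exp (a * s) * (norm (f s))\<^sup>2) / (2 * l))"
      unfolding m_eq by (rule mult_left_mono) auto
    also have "\<dots> = l / (2 * a) + \<rho> t / (2 * l)"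
      by (simp add: \<rho>_eq distrib_left exp_minus field_simps)
    also have "l / (2 * a) = m t / 2" using a by (simp add: l_def)
    finally have "m t \<le> \<rho> t / l" using l by (simp add: field_simps)
    then show ?thesis using a mpos by (simp add: l_def field_simps power2_eq_square)
  qed (use a \<rho>_nonneg in auto)
  have bound: "integral {0..T} (\<lambda>t. (norm (convolve_exp z f t))\<^sup>2) \<le> energy f / a\<^sup>2" if T: "T \<ge> 0" for T
  proof -
    have \<rho>i: "\<rho> integrable_on {0..T}"
      by (rule integrable_continuous_real[OF continuous_on_subset[OF cont\<rho>]]) auto
    have f2: "(\<lambda>t. (norm (f t))\<^sup>2) integrable_on {0..T}"
      using f2i[of T] by (simp add: absolutely_integrable_on_def)
    have "integral {0..T} (\<lambda>t. (norm (convolve_exp z f t))\<^sup>2) \<le> integral {0..T} (\<lambda>t. \<rho> t / a)"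
    proof (rule integral_le)
      show "(\<lambda>t. (norm (convolve_exp z f t))\<^sup>2) integrable_on {0..T}"
        by (intro integrable_continuous_real continuous_intros continuous_on_subset[OF contr]) auto
      fix t assume "t \<in> {0..T}"
      have "(norm (convolve_exp z f t))\<^sup>2 \<le> (m t)\<^sup>2" by (rule power_mono[OF rm]) simp
      also have "\<dots> \<le> \<rho> t / a" using m\<rho> \<open>t \<in> {0..T}\<close> by simp
      finally show "(norm (convolve_exp z f t))\<^sup>2 \<le> \<rho> t / a" .
    qed (use \<rho>i in \<open>auto intro: integrable_on_divide\<close>)
    also have "\<dots> = integral {0..T} \<rho> / a" by simp
    also have "\<dots> \<le> (energy f / a) / a"
    proof (rule divide_right_mono)
      have "((\<lambda>s. - a * \<rho> s + (norm (f s))\<^sup>2) has_integral - a * integral {0..T} \<rho> + integral {0..T} (\<lambda>s. (norm (f s))\<^sup>2)) {0..T}"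
        using \<rho>i f2 by (intro has_integral_add has_integral_mult_right) (auto simp: has_integral_iff)
      with \<rho>[OF T] have "\<rho> T = - a * integral {0..T} \<rho> + integral {0..T} (\<lambda>s. (norm (f s))\<^sup>2)"
        by (rule has_integral_unique)
      then have "a * integral {0..T} \<rho> \<le> integral {0..T} (\<lambda>s. (norm (f s))\<^sup>2)"
        using \<rho>_nonneg[of T] by simp
      also have "\<dots> \<le> energy f"
        unfolding energy_def using f f2 by (intro integral_subset_le) (auto simp: sq_integrable_def)
      finally show "integral {0..T} \<rho> \<le> energy f / a" using a by (simp add: field_simps)
    qed (use a in auto)
    finally show ?thesis by (simp add: power2_eq_square)
  qed
  show "sq_integrable (convolve_exp z f)" "energy (convolve_exp z f) \<le> energy f / (Re z)\<^sup>2"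
    using sq_integrable_continuousI[OF contr bound] by (auto simp: a_def)
qed

section \<open>Annihilating polynomials and finite gain of Hurwitz systems\<close>

text \<open>The vector \<open>p(A) v\<close>, computed by the Horner scheme. Complex scalars act on vectors by \<open>*s\<close>.\<close>
definition poly_act :: "complex ^ 'n ^ 'n \<Rightarrow> complex poly \<Rightarrow> complex ^ 'n \<Rightarrow> complex ^ 'n" where
  "poly_act A p v = fold_coeffs (\<lambda>a w. a *s v + A *v w) p 0"

lemma poly_act_0 [simp]: "poly_act A 0 v = 0"
  by (simp add: poly_act_def)

lemma poly_act_pCons [simp]: "poly_act A (pCons a p) v = a *s v + A *v poly_act A p v"
  by (cases "p = 0 \<and> a = 0") (auto simp: poly_act_def)

lemma poly_act_add: "poly_act A (p + q) v = poly_act A p v + poly_act A q v"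
  by (induction p q rule: poly_induct2)
    (simp_all add: matrix_vector_right_distrib vector_sadd_rdistrib)

lemma matrix_vector_mult_smult: "A *v (c *s v) = c *s (A *v (v :: 'a::comm_semiring_1 ^ 'n))"
  by (simp add: vec_eq_iff matrix_vector_mult_def sum_distrib_left mult_ac)

lemma poly_act_smult: "poly_act A (smult c p) v = c *s poly_act A p v"
  by (induction p) (simp_all add: matrix_vector_mult_smult vector_add_ldistrib vector_smult_assoc)

lemma poly_act_sum: "poly_act A (sum p I) v = (\<Sum>i\<in>I. poly_act A (p i) v)"
  by (induction I rule: infinite_finite_induct) (simp_all add: poly_act_add)

lemma poly_act_linear_factor:
  "poly_act A ([:- z, 1:] * q) v = A *v poly_act A q v - z *s poly_act A q v"
proof -
  have "[:- z, 1:] * q = smult (- z) q + pCons 0 q" by (simp add: mult_pCons_left)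
  then show ?thesis
    by (simp add: poly_act_add poly_act_smult vec_eq_iff del: smult_minus_left)
qed

lemma poly_act_mult_smult: "poly_act A p (c *s v) = c *s poly_act A p v"
  by (induction p) (simp_all add: matrix_vector_mult_smult vector_add_ldistrib vector_smult_assoc mult.commute)

lemma linear_poly_act: "linear (poly_act A p)"
proof (rule linearI)
  show "poly_act A p (v + w) = poly_act A p v + poly_act A p w" for v w
    by (induction p) (simp_all add: matrix_vector_right_distrib vector_add_ldistrib)
  show "poly_act A p (c *\<^sub>R v) = c *\<^sub>R poly_act A p v" for c v
  proof -
    have *: "c *\<^sub>R v = complex_of_real c *s v" for v :: "complex ^ 'a"
      by (simp add: vec_eq_iff scaleR_conv_of_real[where 'a = complex])
    show ?thesis by (simp add: * poly_act_mult_smult)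
  qed
qed

text \<open>Dependence is stated for the sequence, not for its range, so that repeated terms count.\<close>
lemma linearly_dependent_sequence:
  fixes B :: "nat \<Rightarrow> 'a::euclidean_space"
  obtains c :: "nat \<Rightarrow> real" and n where "\<exists>i\<le>n. c i \<noteq> 0" "(\<Sum>i\<le>n. c i *\<^sub>R B i) = 0"
proof (cases "inj B")
  case False
  then obtain i j where ij: "i \<noteq> j" "B i = B j" by (auto simp: inj_def)
  let ?c = "\<lambda>k. (if k = i then 1 else 0) - (if k = j then 1 else (0::real))"
  have "(\<Sum>k\<le>max i j. ?c k *\<^sub>R B k) = (\<Sum>k\<le>max i j. (if k = i then B k else 0) - (if k = j then B k else 0))"
    by (intro sum.cong) auto
  also have "\<dots> = 0" using ij by (simp add: sum_subtractf)
  finally show ?thesis using ij by (intro that[of "max i j" ?c]) (auto intro!: exI[of _ i])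
next
  case True
  let ?n = "DIM('a)"
  have inj: "inj_on B {..?n}" using True by (rule inj_on_subset) auto
  have "dependent (B ` {..?n})"
    by (rule dependent_biggerset) (simp_all add: card_image[OF inj])
  then obtain u where u: "\<exists>v\<in>B ` {..?n}. u v \<noteq> 0" "(\<Sum>v\<in>B ` {..?n}. u v *\<^sub>R v) = 0"
    by (subst (asm) real_vector.dependent_finite) auto
  show ?thesis
  proof (rule that[of ?n "\<lambda>i. u (B i)"])
    show "(\<Sum>i\<le>?n. u (B i) *\<^sub>R B i) = 0" using u(2) by (simp add: sum.reindex[OF inj])
  qed (use u(1) in auto)
qed

text \<open>The powers of \<open>A\<close> live in a finite-dimensional space, hence are linearly dependent. Real
  coefficients suffice, so the dimension over the reals can be used.\<close>
lemma annihilating_poly_exists: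
  obtains p where "p \<noteq> 0" "\<And>v. poly_act A p v = 0"
proof -
  define B where "B i = ((\<lambda>M. A ** M) ^^ i) (mat 1)" for i
  obtain c :: "nat \<Rightarrow> real" and n where c: "\<exists>i\<le>n. c i \<noteq> 0" "(\<Sum>i\<le>n. c i *\<^sub>R B i) = 0"
    by (rule linearly_dependent_sequence)
  have mon: "poly_act A (monom a i) v = a *s (B i *v v)" for a i v
    by (induction i) (simp_all add: monom_0 monom_Suc B_def matrix_vector_mul_assoc[symmetric] matrix_vector_mult_smult)
  define p where "p = (\<Sum>i\<le>n. monom (complex_of_real (c i)) i)"
  have "p \<noteq> 0"
  proof -
    obtain i where i: "i \<le> n" "c i \<noteq> 0" using c(1) by auto
    have "coeff p i = of_real (c i)" using i by (simp add: p_def coeff_sum)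
    then show ?thesis using i by auto
  qed
  moreover have "poly_act A p v = 0" for v
  proof -
    have "poly_act A p v = (\<Sum>i\<le>n. complex_of_real (c i) *s (B i *v v))"
      by (simp add: p_def poly_act_sum mon)
    also have "\<dots> = (\<Sum>i\<le>n. c i *\<^sub>R B i) *v v"
    proof (induction n)
      case (Suc n)
      have "(c (Suc n) *\<^sub>R B (Suc n)) *v v = complex_of_real (c (Suc n)) *s (B (Suc n) *v v)"
        by (simp add: vec_eq_iff matrix_vector_mult_def sum_distrib_left mult.assoc
            scaleR_conv_of_real[where 'a = complex])
      with Suc show ?case by (simp add: matrix_vector_mult_add_rdistrib)
    qed (simp add: vec_eq_iff matrix_vector_mult_def sum_distrib_left mult.assoc
            scaleR_conv_of_real[where 'a = complex])
    also have "\<dots> = 0" by (simp add: c(2) vec_eq_iff matrix_vector_mult_def)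
    finally show ?thesis .
  qed
  ultimately show ?thesis by (rule that)
qed

text \<open>An annihilating polynomial of least degree has only eigenvalues as roots: if \<open>p\<close> is
  \<open>[:- z, 1:] * q\<close>, then some \<open>q(A) v\<close> is nonzero, and it is an eigenvector for \<open>z\<close>.\<close>
lemma stable_annihilating_poly_exists:
  assumes ev: "\<And>z v. v \<noteq> 0 \<Longrightarrow> A *v v = z *s v \<Longrightarrow> Re z < 0"
  obtains p where "p \<noteq> 0" "\<And>v. poly_act A p v = 0" "\<And>z. poly p z = 0 \<Longrightarrow> Re z < 0"
proof -
  define P where "P p \<longleftrightarrow> p \<noteq> 0 \<and> (\<forall>v. poly_act A p v = 0)" for p
  obtain p0 where "P p0" using annihilating_poly_exists[of A] P_def by metis
  then obtain p where p: "P p" "\<And>q. P q \<Longrightarrow> degree p \<le> degree q"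
    using ex_has_least_nat[of P p0 degree] by auto
  show ?thesis
  proof (rule that[of p])
    fix z assume "poly p z = 0"
    then obtain q where q: "p = [:- z, 1:] * q" by (auto simp: poly_eq_0_iff_dvd)
    have "q \<noteq> 0" using p(1) by (auto simp: q P_def)
    then have "degree p = Suc (degree q)" by (simp add: q degree_mult_eq del: mult_pCons_left)
    then have "\<not> P q" using p(2)[of q] by auto
    then obtain v where v: "poly_act A q v \<noteq> 0" using \<open>q \<noteq> 0\<close> by (auto simp: P_def)
    have "A *v poly_act A q v = z *s poly_act A q v"
      using p(1) poly_act_linear_factor[of A z q v] by (simp add: q P_def)
    with v show "Re z < 0" by (rule ev)
  qed (use p(1) in \<open>auto simp: P_def\<close>)
qed

text \<open>The initial value problem \<open>x' = A x + N w\<close>, \<open>x 0 = 0\<close> has for each square integrable \<open>w\<close> a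
  square integrable solution, with an energy gain \<open>g\<close> independent of \<open>w\<close>. The differential
  equation is written in integral form.\<close>
definition stably_solvable :: "complex ^ 'n ^ 'n \<Rightarrow> (complex ^ 'n \<Rightarrow> complex ^ 'n) \<Rightarrow> bool" where
  "stably_solvable A N \<longleftrightarrow> (\<exists>g\<ge>0. \<forall>w. sq_integrable w \<longrightarrow>
     (\<exists>x. continuous_on {0..} x \<and> (\<forall>t\<ge>0. ((\<lambda>s. A *v x s + N (w s)) has_integral x t) {0..t})
        \<and> sq_integrable x \<and> energy x \<le> g * energy w))"

text \<open>If \<open>r' = z r + w\<close> and \<open>y' = A y + (A - z) N r\<close>, then \<open>x = y + N r\<close> solves \<open>x' = A x + N w\<close>.
  Hence a linear factor \<open>A - z\<close> with \<open>Re z < 0\<close> can be cancelled from the input map.\<close>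
lemma stably_solvable_linear_factor:
  assumes N: "linear N" "\<And>c v. N (c *s v) = c *s N v" and z: "Re z < 0"
    and solv: "stably_solvable A (\<lambda>v. A *v N v - z *s N v)"
  shows "stably_solvable A N"
proof -
  obtain g where g: "g \<ge> 0" and sol: "\<And>w. sq_integrable w \<Longrightarrow>
     \<exists>x. continuous_on {0..} x \<and> (\<forall>t\<ge>0. ((\<lambda>s. A *v x s + (A *v N (w s) - z *s N (w s))) has_integral x t) {0..t})
        \<and> sq_integrable x \<and> energy x \<le> g * energy w"
    using solv by (auto simp: stably_solvable_def)
  obtain K where K: "K \<ge> 0" and Nsq: "\<And>f. sq_integrable f \<Longrightarrow> sq_integrable (\<lambda>t. N (f t))"
    and Nen: "\<And>f. sq_integrable f \<Longrightarrow> energy (\<lambda>t. N (f t)) \<le> K * energy f"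
    using sq_integrable_linear[OF N(1)] by blast
  have blN: "bounded_linear N" using N(1) by (simp add: linear_conv_bounded_linear)
  have "\<exists>x. continuous_on {0..} x \<and> (\<forall>t\<ge>0. ((\<lambda>s. A *v x s + N (w s)) has_integral x t) {0..t})
        \<and> sq_integrable x \<and> energy x \<le> (2 * g + 2 * K) / (Re z)\<^sup>2 * energy w" if w: "sq_integrable w" for w
  proof -
    note wi = sq_integrable_vecD[OF w]
    define r where "r t = (\<chi> i. convolve_exp z (\<lambda>s. w s $ i) t)" for t
    have rc: "continuous_on {0..} r"
      unfolding r_def
      by (intro continuous_on_vec_lambda continuous_on_convolve_exp sq_integrable_imp_absolutely_integrable wi)
    have ri: "((\<lambda>s. z *s r s + w s) has_integral r t) {0..t}" if "t \<ge> 0" for t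
      unfolding has_integral_vec_iff
      using convolve_exp_integral_equation[OF sq_integrable_imp_absolutely_integrable(1)[OF wi] that, of z]
      by (simp add: r_def)
    have rsq: "sq_integrable r"
      by (rule sq_integrable_vecI) (simp add: r_def convolve_exp_decay[OF z wi])
    have "energy r = (\<Sum>i\<in>UNIV. energy (\<lambda>t. r t $ i))"
      by (rule sq_integrable_vecI) (simp add: r_def convolve_exp_decay[OF z wi])
    also have "\<dots> \<le> (\<Sum>i\<in>UNIV. energy (\<lambda>t. w t $ i) / (Re z)\<^sup>2)"
      by (rule sum_mono) (use convolve_exp_decay(2)[OF z wi] in \<open>simp add: r_def\<close>)
    also have "\<dots> = energy w / (Re z)\<^sup>2"
      by (simp add: sum_divide_distrib sq_integrable_vecI(2)[OF wi])
    finally have ren: "energy r \<le> energy w / (Re z)\<^sup>2" .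
    obtain y where yc: "continuous_on {0..} y" and ysq: "sq_integrable y" and yen: "energy y \<le> g * energy r"
      and yi: "\<And>t. t \<ge> 0 \<Longrightarrow> ((\<lambda>s. A *v y s + (A *v N (r s) - z *s N (r s))) has_integral y t) {0..t}"
      using sol[OF rsq] by auto
    define x where "x t = y t + N (r t)" for t
    have "continuous_on {0..} x"
      unfolding x_def by (intro continuous_intros yc bounded_linear.continuous_on[OF blN] rc)
    moreover have "((\<lambda>s. A *v x s + N (w s)) has_integral x t) {0..t}" if t: "t \<ge> 0" for t
    proof -
      have "((\<lambda>s. A *v y s + (A *v N (r s) - z *s N (r s)) + N (z *s r s + w s)) has_integral x t) {0..t}"
        unfolding x_def using has_integral_linear[OF ri[OF t] blN]
        by (intro has_integral_add yi t) (simp add: o_def)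
      moreover have "A *v y s + (A *v N (r s) - z *s N (r s)) + N (z *s r s + w s) = A *v x s + N (w s)" for s
        by (simp add: x_def linear_add[OF N(1)] N(2) matrix_vector_right_distrib)
      ultimately show ?thesis by simp
    qed
    moreover have "sq_integrable x" unfolding x_def by (intro sq_integrable_add ysq Nsq rsq)
    moreover have "energy x \<le> (2 * g + 2 * K) / (Re z)\<^sup>2 * energy w"
    proof -
      have "energy x \<le> 2 * energy y + 2 * energy (\<lambda>t. N (r t))"
        unfolding x_def by (intro sq_integrable_add ysq Nsq rsq)
      also have "\<dots> \<le> 2 * (g * energy r) + 2 * (K * energy r)"
        using yen Nen[OF rsq] by simp
      also have "\<dots> = (2 * g + 2 * K) * energy r" by (simp add: algebra_simps)
      also have "\<dots> \<le> (2 * g + 2 * K) * (energy w / (Re z)\<^sup>2)"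
        using ren g K by (intro mult_left_mono) auto
      finally show ?thesis by simp
    qed
    ultimately show ?thesis by blast
  qed
  then show ?thesis unfolding stably_solvable_def using g K by (intro exI[of _ "(2 * g + 2 * K) / (Re z)\<^sup>2"]) auto
qed

text \<open>Cancelling all linear factors of \<open>p\<close> one after the other leaves a nonzero constant.\<close>
lemma stably_solvable_poly_act:
  assumes "p \<noteq> 0" "\<And>z. poly p z = 0 \<Longrightarrow> Re z < 0" "stably_solvable A (poly_act A p)"
  shows "stably_solvable A (\<lambda>v. v)"
  using assms
proof (induction "degree p" arbitrary: p)
  case 0
  then obtain c where c: "p = [:c:]" "c \<noteq> 0" by (metis degree_eq_zeroE pCons_0_0)
  obtain g where g: "g \<ge> 0" and sol: "\<And>w. sq_integrable w \<Longrightarrow>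
     \<exists>x. continuous_on {0..} x \<and> (\<forall>t\<ge>0. ((\<lambda>s. A *v x s + poly_act A p (w s)) has_integral x t) {0..t})
        \<and> sq_integrable x \<and> energy x \<le> g * energy w"
    using 0 by (auto simp: stably_solvable_def)
  have lin: "linear (\<lambda>v :: complex ^ 'a. (1 / c) *s v)"
  proof -
    have "poly_act A [:1 / c:] = (\<lambda>v. (1 / c) *s v)" by (simp add: fun_eq_iff)
    then show ?thesis using linear_poly_act[of A "[:1 / c:]"] by simp
  qed
  obtain K where K: "K \<ge> 0" and Ksq: "\<And>w :: real \<Rightarrow> complex ^ 'a. sq_integrable w \<Longrightarrow> sq_integrable (\<lambda>t. (1 / c) *s w t)"
    and Ken: "\<And>w :: real \<Rightarrow> complex ^ 'a. sq_integrable w \<Longrightarrow> energy (\<lambda>t. (1 / c) *s w t) \<le> K * energy w"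
    using sq_integrable_linear[OF lin] by metis
  have "\<exists>x. continuous_on {0..} x \<and> (\<forall>t\<ge>0. ((\<lambda>s. A *v x s + w s) has_integral x t) {0..t})
        \<and> sq_integrable x \<and> energy x \<le> g * K * energy w" if w: "sq_integrable w" for w
  proof -
    have "poly_act A p ((1 / c) *s v) = v" for v
      using c by (simp add: vector_smult_assoc)
    then obtain x where "continuous_on {0..} x" "\<forall>t\<ge>0. ((\<lambda>s. A *v x s + w s) has_integral x t) {0..t}"
        "sq_integrable x" and en: "energy x \<le> g * energy (\<lambda>t. (1 / c) *s w t)"
      using sol[OF Ksq[OF w]] by auto
    moreover have "g * energy (\<lambda>t. (1 / c) *s w t) \<le> g * (K * energy w)"
      by (rule mult_left_mono[OF Ken[OF w] g])
    ultimately show ?thesis by (intro exI[of _ x]) (simp add: mult.assoc)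
  qed
  then show ?case unfolding stably_solvable_def using g K by (intro exI[of _ "g * K"]) auto
next
  case (Suc n)
  then have "\<not> constant (poly p)" by (simp add: constant_degree)
  then obtain z where z: "poly p z = 0" using fundamental_theorem_of_algebra by blast
  then obtain q where q: "p = [:- z, 1:] * q" by (auto simp: poly_eq_0_iff_dvd)
  have "q \<noteq> 0" using Suc by (auto simp: q)
  then have "degree p = Suc (degree q)" by (simp add: q degree_mult_eq del: mult_pCons_left)
  moreover have "poly_act A p = (\<lambda>v. A *v poly_act A q v - z *s poly_act A q v)"
    by (simp only: fun_eq_iff q poly_act_linear_factor simp_thms)
  then have "stably_solvable A (\<lambda>v. A *v poly_act A q v - z *s poly_act A q v)"
    using Suc.prems(3) by simp
  then have "stably_solvable A (poly_act A q)"
    by (rule stably_solvable_linear_factor[OF linear_poly_act poly_act_mult_smult Suc.prems(2)[OF z]])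
  moreover have "Re y < 0" if "poly q y = 0" for y
    using Suc.prems(2)[of y] that by (simp add: q)
  ultimately show ?case using Suc.hyps(2) by (intro Suc.hyps(1)[of q] \<open>q \<noteq> 0\<close>) simp_all
qed

text \<open>For an annihilating polynomial \<open>p\<close> the input \<open>p(A) w\<close> vanishes, so \<open>x = 0\<close> is a solution and
  the cancellation of factors can start from there.\<close>
lemma stably_solvable_complex:
  assumes ev: "\<And>z v. v \<noteq> 0 \<Longrightarrow> A *v v = z *s v \<Longrightarrow> Re z < 0"
  shows "stably_solvable A (\<lambda>v. v)"
proof -
  obtain p where p: "p \<noteq> 0" "\<And>v. poly_act A p v = 0" "\<And>z. poly p z = 0 \<Longrightarrow> Re z < 0"
    by (rule stable_annihilating_poly_exists[OF ev]) auto
  have "sq_integrable (\<lambda>t. 0 :: complex ^ 'a)" "energy (\<lambda>t. 0 :: complex ^ 'a) = 0"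
    by (auto simp: sq_integrable_def energy_def intro: integrable_0)
  then have "stably_solvable A (poly_act A p)"
    unfolding stably_solvable_def p(2)
    by (intro exI[of _ 0] conjI allI impI exI[of _ "\<lambda>t. 0"]) auto
  with p(1,3) show ?thesis by (rule stably_solvable_poly_act)
qed

text \<open>The real part of a solution of the complexified system solves the real one.\<close>
lemma hurwitz_L2_stable:
  fixes A :: "real ^ 'n ^ 'n"
  assumes "hurwitz A"
  obtains g where "g \<ge> 0" "\<And>w. sq_integrable w \<Longrightarrow>
     \<exists>x. continuous_on {0..} x \<and> (\<forall>t\<ge>0. ((\<lambda>s. A *v x s + w s) has_integral x t) {0..t})
        \<and> sq_integrable x \<and> energy x \<le> g * energy w"
proof -
  let ?A = "map_matrix complex_of_real A"
  define re where "re v = (\<chi> i. Re (v $ i))" for v :: "complex ^ 'n"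
  define cx where "cx v = (\<chi> i. complex_of_real (v $ i))" for v :: "real ^ 'n"
  have lre: "linear re" by (rule linearI) (simp_all add: re_def vec_eq_iff)
  have lcx: "linear cx" by (rule linearI) (simp_all add: cx_def vec_eq_iff scaleR_conv_of_real[where 'a = complex])
  have re_cx: "re (cx v) = v" for v by (simp add: re_def cx_def vec_eq_iff)
  have re_mult: "re (?A *v v) = A *v re v" for v
    by (simp add: re_def vec_eq_iff matrix_vector_mult_def)
  have "stably_solvable ?A (\<lambda>v. v)"
    using assms by (intro stably_solvable_complex) (auto simp: hurwitz_def)
  then obtain g where g: "g \<ge> 0" and sol: "\<And>w. sq_integrable w \<Longrightarrow>
     \<exists>x. continuous_on {0..} x \<and> (\<forall>t\<ge>0. ((\<lambda>s. ?A *v x s + w s) has_integral x t) {0..t})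
        \<and> sq_integrable x \<and> energy x \<le> g * energy w"
    by (auto simp: stably_solvable_def)
  obtain K where K: "K \<ge> 0" and resq: "\<And>f. sq_integrable f \<Longrightarrow> sq_integrable (\<lambda>t. re (f t))"
    and reen: "\<And>f. sq_integrable f \<Longrightarrow> energy (\<lambda>t. re (f t)) \<le> K * energy f"
    using sq_integrable_linear[OF lre] by blast
  obtain L where L: "L \<ge> 0" and cxsq: "\<And>f. sq_integrable f \<Longrightarrow> sq_integrable (\<lambda>t. cx (f t))"
    and cxen: "\<And>f. sq_integrable f \<Longrightarrow> energy (\<lambda>t. cx (f t)) \<le> L * energy f"
    using sq_integrable_linear[OF lcx] by blast
  have blre: "bounded_linear re" using lre by (simp add: linear_conv_bounded_linear)
  show ?thesis
  proof (rule that[of "K * g * L"])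
    fix w :: "real \<Rightarrow> real ^ 'n" assume w: "sq_integrable w"
    obtain x where x: "continuous_on {0..} x" "sq_integrable x" "energy x \<le> g * energy (\<lambda>t. cx (w t))"
      and xi: "\<And>t. t \<ge> 0 \<Longrightarrow> ((\<lambda>s. ?A *v x s + cx (w s)) has_integral x t) {0..t}"
      using sol[OF cxsq[OF w]] by auto
    have "((\<lambda>s. A *v re (x s) + w s) has_integral re (x t)) {0..t}" if "t \<ge> 0" for t
      using has_integral_linear[OF xi[OF that] blre]
      by (simp add: o_def linear_add[OF lre] re_mult re_cx)
    moreover have "continuous_on {0..} (\<lambda>t. re (x t))"
      by (rule bounded_linear.continuous_on[OF blre x(1)])
    moreover have "energy (\<lambda>t. re (x t)) \<le> K * g * L * energy w"
    proof -
      have "energy (\<lambda>t. re (x t)) \<le> K * energy x" by (rule reen[OF x(2)])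
      also have "\<dots> \<le> K * (g * (L * energy w))"
        using K g cxen[OF w] by (intro mult_left_mono order_trans[OF x(3)]) auto
      finally show ?thesis by (simp add: mult.assoc)
    qed
    ultimately show "\<exists>x. continuous_on {0..} x \<and> (\<forall>t\<ge>0. ((\<lambda>s. A *v x s + w s) has_integral x t) {0..t})
        \<and> sq_integrable x \<and> energy x \<le> K * g * L * energy w"
      using resq[OF x(2)] by (intro exI[of _ "\<lambda>t. re (x t)"]) auto
  qed (use K g L in auto)
qed

section \<open>States and outputs of linear systems\<close>

text \<open>If \<open>K\<close> bounds \<open>A\<close>, then \<open>exp (- 2 * K * t) * (x t \<bullet> x t)\<close> is nonincreasing; it is zero at
  \<open>t0\<close>.\<close>
lemma homogeneous_integral_equation_unique:
  fixes A :: "real ^ 'n ^ 'n" and x :: "real \<Rightarrow> real ^ 'n"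
  assumes cont: "continuous_on {t0..} x"
    and int: "\<And>t. t \<ge> t0 \<Longrightarrow> ((\<lambda>s. A *v x s) has_integral x t) {t0..t}"
    and T: "T \<ge> t0"
  shows "x T = 0"
proof -
  have bl: "bounded_linear (\<lambda>v. A *v v)" by simp
  obtain K where K: "\<And>v. norm (A *v v) \<le> norm v * K" using bounded_linear.bounded[OF bl] by blast
  have cA: "continuous_on {t0..T} (\<lambda>s. A *v x s)"
    by (intro bounded_linear.continuous_on[OF bl] continuous_on_subset[OF cont]) auto
  have dx: "(x has_vector_derivative A *v x t) (at t within {t0..T})" if t: "t \<in> {t0..T}" for t
  proof -
    have "((\<lambda>t. integral {t0..t} (\<lambda>s. A *v x s)) has_vector_derivative A *v x t) (at t within {t0..T})"
      by (rule integral_has_vector_derivative[OF cA t])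
    then show ?thesis
      by (rule has_vector_derivative_transform[OF t, rotated])
        (use int in \<open>auto simp: integral_unique[symmetric]\<close>)
  qed
  define V where "V t = exp (- 2 * K * t) * (x t \<bullet> x t)" for t
  have "V T \<le> V t0"
  proof (rule DERIV_nonpos_imp_decreasing_open[OF T])
    show "continuous_on {t0..T} V"
      unfolding V_def by (intro continuous_intros continuous_on_subset[OF cont]) auto
    fix t assume t: "t0 < t" "t < T"
    have d: "(x has_vector_derivative A *v x t) (at t)"
      using dx[of t] t by (simp add: at_within_Icc_at)
    have "((\<lambda>t. x t \<bullet> x t) has_vector_derivative (x t \<bullet> (A *v x t) + (A *v x t) \<bullet> x t)) (at t)"
      by (rule bounded_bilinear.has_vector_derivative[OF bounded_bilinear_inner d d])
    then have "((\<lambda>t. x t \<bullet> x t) has_real_derivative 2 * (x t \<bullet> (A *v x t))) (at t)"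
      by (simp add: has_real_derivative_iff_has_vector_derivative inner_commute)
    then have D: "(V has_real_derivative exp (- 2 * K * t) * (2 * (x t \<bullet> (A *v x t)) - 2 * K * (x t \<bullet> x t))) (at t)"
      unfolding V_def[abs_def] by (auto intro!: derivative_eq_intros simp: algebra_simps)
    have "x t \<bullet> (A *v x t) \<le> norm (x t) * norm (A *v x t)" by (rule norm_cauchy_schwarz)
    also have "\<dots> \<le> norm (x t) * (norm (x t) * K)" by (intro mult_left_mono K) simp
    also have "\<dots> = K * (x t \<bullet> x t)" by (simp add: dot_square_norm power2_eq_square)
    finally show "\<exists>y. (V has_real_derivative y) (at t) \<and> y \<le> 0"
      using D by (intro exI[of _ "exp (- 2 * K * t) * (2 * (x t \<bullet> (A *v x t)) - 2 * K * (x t \<bullet> x t))"])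
        (simp add: mult_nonneg_nonpos)
  qed
  moreover have "x t0 = 0" using int[of t0] by (simp add: has_integral_unique[OF has_integral_refl(2)])
  ultimately have "exp (- 2 * K * T) * (x T \<bullet> x T) \<le> 0" by (simp add: V_def)
  then have "x T \<bullet> x T \<le> 0" by (simp add: mult_le_0_iff)
  then show ?thesis by (metis inner_ge_zero inner_eq_zero_iff order_antisym)
qed

lemma state_solution_unique:
  assumes x: "state_solution S t0 x0 u d x" and y: "state_solution S t0 x0 u d y" and t: "t \<ge> t0"
  shows "x t = y t"
proof -
  have "(\<lambda>t. x t - y t) t = 0"
  proof (rule homogeneous_integral_equation_unique[OF _ _ t, where A = "mat_A S"])
    show "continuous_on {t0..} (\<lambda>t. x t - y t)"
      using x y by (auto simp: state_solution_def intro!: continuous_intros)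
    fix t assume t: "t0 \<le> t"
    have "((\<lambda>s. (mat_A S *v x s + mat_B S *v u s + mat_E S *v d s) - (mat_A S *v y s + mat_B S *v u s + mat_E S *v d s))
        has_integral ((x t - x0) - (y t - x0))) {t0..t}"
      using x y t by (intro has_integral_diff) (auto simp: state_solution_def)
    then show "((\<lambda>s. mat_A S *v (x s - y s)) has_integral x t - y t) {t0..t}"
      by (simp add: matrix_vector_mult_diff_distrib)
  qed
  then show ?thesis by simp
qed

lemma lti_output_eq:
  assumes "state_solution S t0 x0 u d x" "t \<ge> t0"
  shows "lti_output S t0 x0 u d t = mat_C S *v x t"
proof -
  have "(THE \<xi>. \<exists>x. state_solution S t0 x0 u d x \<and> \<xi> = x t) = x t"
    using assms by (intro the_equality) (auto dest: state_solution_unique)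
  then show ?thesis by (simp add: lti_output_def)
qed

lemma stable_state_solution:
  fixes S :: "('n::finite, 'm::finite, 'q::finite, 'p::finite) lti"
  assumes "zero_asymp_stable S"
  obtains g where "g \<ge> 0" "\<And>u d. sq_integrable u \<Longrightarrow> sq_integrable d \<Longrightarrow>
     \<exists>x. state_solution S 0 0 u d x \<and> sq_integrable x \<and> energy x \<le> g * (energy u + energy d)"
proof -
  obtain g where g: "g \<ge> 0" and sol: "\<And>w. sq_integrable w \<Longrightarrow>
     \<exists>x. continuous_on {0..} x \<and> (\<forall>t\<ge>0. ((\<lambda>s. mat_A S *v x s + w s) has_integral x t) {0..t})
        \<and> sq_integrable x \<and> energy x \<le> g * energy w"
    using hurwitz_L2_stable[of "mat_A S"] assms unfolding zero_asymp_stable_def by blast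
  obtain K where K: "K \<ge> 0" and Bsq: "\<And>f. sq_integrable f \<Longrightarrow> sq_integrable (\<lambda>t. mat_B S *v f t)"
    and Ben: "\<And>f. sq_integrable f \<Longrightarrow> energy (\<lambda>t. mat_B S *v f t) \<le> K * energy f"
    using sq_integrable_linear[OF matrix_vector_mul_linear[of "mat_B S"]] by blast
  obtain L where L: "L \<ge> 0" and Esq: "\<And>f. sq_integrable f \<Longrightarrow> sq_integrable (\<lambda>t. mat_E S *v f t)"
    and Een: "\<And>f. sq_integrable f \<Longrightarrow> energy (\<lambda>t. mat_E S *v f t) \<le> L * energy f"
    using sq_integrable_linear[OF matrix_vector_mul_linear[of "mat_E S"]] by blast
  show ?thesis
  proof (rule that[of "g * (2 * K + 2 * L)"])
    fix u :: "real \<Rightarrow> real ^ 'm" and d :: "real \<Rightarrow> real ^ 'q"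
    assume u: "sq_integrable u" and d: "sq_integrable d"
    note w = sq_integrable_add[OF Bsq[OF u] Esq[OF d]]
    obtain x where x: "continuous_on {0..} x" "sq_integrable x"
        "energy x \<le> g * energy (\<lambda>t. mat_B S *v u t + mat_E S *v d t)"
      and xi: "\<And>t. t \<ge> 0 \<Longrightarrow> ((\<lambda>s. mat_A S *v x s + (mat_B S *v u s + mat_E S *v d s)) has_integral x t) {0..t}"
      using sol[OF w(1)] by auto
    have "state_solution S 0 0 u d x"
      using x(1) xi by (simp add: state_solution_def add.assoc)
    moreover have "energy x \<le> g * (2 * K + 2 * L) * (energy u + energy d)"
    proof -
      have "energy (\<lambda>t. mat_B S *v u t + mat_E S *v d t) \<le> 2 * (K * energy u) + 2 * (L * energy d)"
        using w(2) Ben[OF u] Een[OF d] by linarith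
      also have "\<dots> \<le> (2 * K + 2 * L) * (energy u + energy d)"
        using K L energy_nonneg[OF u] energy_nonneg[OF d] by (simp add: algebra_simps)
      finally show ?thesis
        using x(3) g by (simp add: mult.assoc) (meson mult_left_mono order_trans)
    qed
    ultimately show "\<exists>x. state_solution S 0 0 u d x \<and> sq_integrable x
        \<and> energy x \<le> g * (2 * K + 2 * L) * (energy u + energy d)"
      using x(2) by blast
  qed (use g K L in auto)
qed

lemma stable_output_bound:
  fixes S :: "('n::finite, 'm::finite, 'q::finite, 'p::finite) lti"
  assumes "zero_asymp_stable S"
  obtains g where "g \<ge> 0"
    "\<And>u d. sq_integrable u \<Longrightarrow> sq_integrable d \<Longrightarrow> sq_integrable (lti_output S 0 0 u d)"
    "\<And>u d. sq_integrable u \<Longrightarrow> sq_integrable d \<Longrightarrow>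
       energy (lti_output S 0 0 u d) \<le> g * (energy u + energy d)"
proof -
  obtain g where g: "g \<ge> 0" and sol: "\<And>u d. sq_integrable u \<Longrightarrow> sq_integrable d \<Longrightarrow>
     \<exists>x. state_solution S 0 0 u d x \<and> sq_integrable x \<and> energy x \<le> g * (energy u + energy d)"
    using stable_state_solution[OF assms] by blast
  obtain K where K: "K \<ge> 0" and Csq: "\<And>f. sq_integrable f \<Longrightarrow> sq_integrable (\<lambda>t. mat_C S *v f t)"
    and Cen: "\<And>f. sq_integrable f \<Longrightarrow> energy (\<lambda>t. mat_C S *v f t) \<le> K * energy f"
    using sq_integrable_linear[OF matrix_vector_mul_linear[of "mat_C S"]] by blast
  have "sq_integrable (lti_output S 0 0 u d) \<and> energy (lti_output S 0 0 u d) \<le> K * g * (energy u + energy d)"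
    if u: "sq_integrable u" and d: "sq_integrable d" for u d
  proof -
    obtain x where x: "state_solution S 0 0 u d x" "sq_integrable x" "energy x \<le> g * (energy u + energy d)"
      using sol[OF u d] by blast
    note eq = lti_output_eq[OF x(1)]
    have "energy (lti_output S 0 0 u d) = energy (\<lambda>t. mat_C S *v x t)"
      by (rule sq_integrable_cong(2)[OF eq])
    also have "\<dots> \<le> K * energy x" by (rule Cen[OF x(2)])
    also have "\<dots> \<le> K * (g * (energy u + energy d))" by (rule mult_left_mono[OF x(3) K])
    finally show ?thesis using Csq[OF x(2)] sq_integrable_cong(1)[OF eq] by (simp add: mult.assoc)
  qed
  then show ?thesis using that[of "K * g"] g K by auto
qed

section \<open>Series interconnection\<close>

lemma col_nth [simp]: "col a b $ Inl i = a $ i" "col a b $ Inr j = b $ j"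
  by (simp_all add: col_def)

lemma vec_sum_eq_iff: 
  "(v = (w :: 'a ^ ('b::finite + 'c::finite))) \<longleftrightarrow>
     (\<forall>i. v $ Inl i = w $ Inl i) \<and> (\<forall>j. v $ Inr j = w $ Inr j)"
  unfolding vec_eq_iff by (rule split_sum_all)

lemma sum_UNIV_sum:
  fixes f :: "'a::finite + 'b::finite \<Rightarrow> 'c::comm_monoid_add"
  shows "sum f UNIV = (\<Sum>i\<in>UNIV. f (Inl i)) + (\<Sum>j\<in>UNIV. f (Inr j))"
  unfolding UNIV_Plus_UNIV[symmetric] by (subst sum.Plus) auto

lemma block_mat_mult_col:
  "block_mat P Q R S *v col a b = col (P *v a + Q *v b) (R *v a + S *v b)"
  by (simp add: vec_sum_eq_iff matrix_vector_mult_def sum_UNIV_sum block_mat_def)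

lemma col_add: "col a b + col c d = col (a + c) (b + d)"
  by (simp add: vec_sum_eq_iff)

lemma sq_integrable_col:
  assumes "sq_integrable f" "sq_integrable g"
  shows "sq_integrable (\<lambda>t. col (f t) (g t))"
    and "energy (\<lambda>t. col (f t) (g t)) = energy f + energy g"
proof -
  have *: "sq_integrable (\<lambda>t. col (f t) (g t) $ k)" for k
    using assms by (cases k) (auto intro: sq_integrable_vecD)
  show "sq_integrable (\<lambda>t. col (f t) (g t))" by (rule sq_integrable_vecI(1)[OF *])
  show "energy (\<lambda>t. col (f t) (g t)) = energy f + energy g"
    using assms by (simp add: sq_integrable_vecI(2)[OF *] sum_UNIV_sum sq_integrable_vecI(2) sq_integrable_vecD)
qed

lemma sq_integrable_colE:
  fixes d :: "real \<Rightarrow> real ^ ('a::finite + 'b::finite)"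
  assumes "sq_integrable d"
  obtains d1 d2 where "d = (\<lambda>t. col (d1 t) (d2 t))" "sq_integrable d1" "sq_integrable d2"
proof (rule that)
  let ?d1 = "\<lambda>t. \<chi> i. d t $ Inl i" and ?d2 = "\<lambda>t. \<chi> j. d t $ Inr j"
  show "d = (\<lambda>t. col (?d1 t) (?d2 t))" by (simp add: fun_eq_iff vec_sum_eq_iff)
  show "sq_integrable ?d1" "sq_integrable ?d2"
    by (rule sq_integrable_vecI; simp add: sq_integrable_vecD[OF assms])+
qed

text \<open>The input \<open>v\<close> of the second system only has to agree with the output of the first one after
  the initial time.\<close>
lemma state_solution_series:
  assumes x1: "state_solution S1 t0 a u d1 x1" and x2: "state_solution S2 t0 b v d2 x2"
    and v: "\<And>t. t \<ge> t0 \<Longrightarrow> v t = mat_C S1 *v x1 t"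
  shows "state_solution (series S1 S2) t0 (col a b) u (\<lambda>t. col (d1 t) (d2 t)) (\<lambda>t. col (x1 t) (x2 t))"
  unfolding state_solution_def
proof (intro conjI allI impI)
  have "continuous_on {t0..} (\<lambda>t. \<chi> k. case k of Inl i \<Rightarrow> x1 t $ i | Inr j \<Rightarrow> x2 t $ j)"
  proof (rule continuous_on_vec_lambda)
    show "continuous_on {t0..} (\<lambda>t. case k of Inl i \<Rightarrow> x1 t $ i | Inr j \<Rightarrow> x2 t $ j)" for k
      using x1 x2 unfolding state_solution_def by (cases k) (auto intro!: continuous_intros)
  qed
  then show "continuous_on {t0..} (\<lambda>t. col (x1 t) (x2 t))" by (simp add: col_def)
  fix t assume t: "t0 \<le> t"
  have B: "mat_B (series S1 S2) *v u s = col (mat_B S1 *v u s) 0" for s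
    by (simp add: series_def vec_sum_eq_iff matrix_vector_mult_def)
  have rhs: "mat_A (series S1 S2) *v col (x1 s) (x2 s) + mat_B (series S1 S2) *v u s + mat_E (series S1 S2) *v col (d1 s) (d2 s)
     = col (mat_A S1 *v x1 s + mat_B S1 *v u s + mat_E S1 *v d1 s)
        (mat_A S2 *v x2 s + mat_B S2 *v v s + mat_E S2 *v d2 s)" if "s \<in> {t0..t}" for s
    using that v[of s] unfolding B
    by (simp add: series_def block_mat_mult_col col_add matrix_vector_mul_assoc add_ac)
  have "((\<lambda>s. col (mat_A S1 *v x1 s + mat_B S1 *v u s + mat_E S1 *v d1 s)
        (mat_A S2 *v x2 s + mat_B S2 *v v s + mat_E S2 *v d2 s)) has_integral col (x1 t) (x2 t) - col a b) {t0..t}"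
    using x1 x2 t by (simp add: state_solution_def has_integral_vec_iff split_sum_all)
  then show "((\<lambda>s. mat_A (series S1 S2) *v col (x1 s) (x2 s) + mat_B (series S1 S2) *v u s + mat_E (series S1 S2) *v col (d1 s) (d2 s))
       has_integral col (x1 t) (x2 t) - col a b) {t0..t}"
    by (rule has_integral_eq[rotated]) (simp only: rhs)
qed

lemma lti_output_series:
  fixes S1 :: "('n1::finite, 'm::finite, 'q1::finite, 'p::finite) lti"
    and S2 :: "('n2::finite, 'p, 'q2::finite, 'r::finite) lti"
  assumes st: "zero_asymp_stable S1" "zero_asymp_stable S2"
    and u: "sq_integrable u" and d: "sq_integrable d1" "sq_integrable d2" and t: "t \<ge> 0"
  shows "lti_output (series S1 S2) 0 0 u (\<lambda>t. col (d1 t) (d2 t)) t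
    = lti_output S2 0 0 (lti_output S1 0 0 u d1) d2 t"
proof -
  obtain x1 where x1: "state_solution S1 0 0 u d1 x1"
    using stable_state_solution[OF st(1)] u d(1) by metis
  have "sq_integrable (lti_output S1 0 0 u d1)"
    using stable_output_bound[OF st(1)] u d(1) by metis
  then obtain x2 where x2: "state_solution S2 0 0 (lti_output S1 0 0 u d1) d2 x2"
    using stable_state_solution[OF st(2)] d(2) by metis
  have "state_solution (series S1 S2) 0 (col 0 0) u (\<lambda>t. col (d1 t) (d2 t)) (\<lambda>t. col (x1 t) (x2 t))"
    by (rule state_solution_series[OF x1 x2]) (rule lti_output_eq[OF x1])
  moreover have "col 0 0 = (0 :: real ^ ('n1 + 'n2))" by (simp add: vec_sum_eq_iff)
  ultimately have "lti_output (series S1 S2) 0 0 u (\<lambda>t. col (d1 t) (d2 t)) t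
      = mat_C (series S1 S2) *v col (x1 t) (x2 t)"
    using t by (intro lti_output_eq) simp_all
  also have "\<dots> = mat_C S2 *v x2 t"
    by (simp add: series_def vec_eq_iff matrix_vector_mult_def sum_UNIV_sum)
  finally show ?thesis using lti_output_eq[OF x2 t] by simp
qed

text \<open>The state matrix is block triangular: the first block of an eigenvector is an eigenvector of
  the first system or zero, and in the latter case the second block is one of the second system.\<close>
lemma zero_asymp_stable_series:
  fixes S1 :: "('n1::finite, 'm::finite, 'q1::finite, 'p::finite) lti"
    and S2 :: "('n2::finite, 'p, 'q2::finite, 'r::finite) lti"
  assumes "zero_asymp_stable S1" "zero_asymp_stable S2"
  shows "zero_asymp_stable (series S1 S2)"
  unfolding zero_asymp_stable_def hurwitz_def
proof (intro allI impI; elim conjE)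
  fix z and v :: "complex ^ ('n1 + 'n2)"
  assume v: "v \<noteq> 0" and ev: "map_matrix complex_of_real (mat_A (series S1 S2)) *v v = z *s v"
  define a where "a = (\<chi> i. v $ Inl i)"
  define b where "b = (\<chi> j. v $ Inr j)"
  have ev_a: "map_matrix complex_of_real (mat_A S1) *v a = z *s a"
  proof -
    have "(map_matrix complex_of_real (mat_A (series S1 S2)) *v v) $ Inl i = (z *s v) $ Inl i" for i
      by (simp only: ev)
    then show ?thesis
      by (simp add: vec_eq_iff a_def series_def block_mat_def matrix_vector_mult_def sum_UNIV_sum)
  qed
  show "Re z < 0"
  proof (cases "a = 0")
    case False
    then show ?thesis using assms(1) ev_a by (auto simp: zero_asymp_stable_def hurwitz_def)
  next
    case True
    then have a0: "v $ Inl i = 0" for i by (simp add: a_def vec_eq_iff)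
    have "(map_matrix complex_of_real (mat_A (series S1 S2)) *v v) $ Inr j = (z *s v) $ Inr j" for j
      by (simp only: ev)
    then have "map_matrix complex_of_real (mat_A S2) *v b = z *s b"
      by (simp add: vec_eq_iff b_def a0 series_def block_mat_def matrix_vector_mult_def sum_UNIV_sum)
    moreover have "b \<noteq> 0" using v a0 by (auto simp: vec_sum_eq_iff b_def vec_eq_iff)
    ultimately show ?thesis using assms(2) by (auto simp: zero_asymp_stable_def hurwitz_def)
  qed
qed

section \<open>Similarity\<close>

text \<open>Similarity in terms of energies, with the norm of the stacked input split into two energies.\<close>
lemma similar_iff:
  "similar \<gamma> \<delta> S S' \<longleftrightarrow> zero_asymp_stable S \<and> zero_asymp_stable S' \<and>
     (\<exists>\<epsilon>>0. \<exists>\<eta>>0. \<exists>\<mu>>0. \<forall>u u' d. sq_integrable u \<longrightarrow> sq_integrable u' \<longrightarrow> sq_integrable d \<longrightarrow>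
        (\<exists>d'. sq_integrable d' \<and>
          sq_integrable (\<lambda>t. lti_output S 0 0 u d t - lti_output S' 0 0 u' d' t) \<and>
          energy (\<lambda>t. lti_output S 0 0 u d t - lti_output S' 0 0 u' d' t)
            \<le> \<gamma> * energy (\<lambda>t. u t - u' t) + (\<delta> - \<epsilon>) * (energy u + energy u')
              + (\<mu> - \<epsilon>) * energy d - \<eta> * energy d'))"
proof -
  have *: "(let y = lti_output S 0 0 u d; y' = lti_output S' 0 0 u' d' in
          sq_integrable (\<lambda>t. y t - y' t) \<and>
          (L2_norm (\<lambda>t. y t - y' t))\<^sup>2
            \<le> \<gamma> * (L2_norm (\<lambda>t. u t - u' t))\<^sup>2
              + (\<delta> - \<epsilon>) * (L2_norm (\<lambda>t. col (u t) (u' t)))\<^sup>2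
              + (\<mu> - \<epsilon>) * (L2_norm d)\<^sup>2 - \<eta> * (L2_norm d')\<^sup>2)
      \<longleftrightarrow> sq_integrable (\<lambda>t. lti_output S 0 0 u d t - lti_output S' 0 0 u' d' t) \<and>
          energy (\<lambda>t. lti_output S 0 0 u d t - lti_output S' 0 0 u' d' t)
            \<le> \<gamma> * energy (\<lambda>t. u t - u' t) + (\<delta> - \<epsilon>) * (energy u + energy u')
              + (\<mu> - \<epsilon>) * energy d - \<eta> * energy d'"
    if "sq_integrable u" "sq_integrable u'" "sq_integrable d" "sq_integrable d'" for u u' d d' \<epsilon> \<eta> \<mu>
    using that by (auto simp: Let_def L2_iff_sq_integrable L2_norm_power2 sq_integrable_diff sq_integrable_col)
  show ?thesis
    unfolding similar_def Ball_def Bex_def L2_iff_sq_integrable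
    by (simp add: * cong: conj_cong)
qed

lemma similarI:
  assumes "zero_asymp_stable S" "zero_asymp_stable S'"
    and "\<epsilon> > 0" "\<eta> > 0" "\<mu> > 0"
    and "\<And>u u' d. sq_integrable u \<Longrightarrow> sq_integrable u' \<Longrightarrow> sq_integrable d \<Longrightarrow>
        \<exists>d'. sq_integrable d' \<and>
          sq_integrable (\<lambda>t. lti_output S 0 0 u d t - lti_output S' 0 0 u' d' t) \<and>
          energy (\<lambda>t. lti_output S 0 0 u d t - lti_output S' 0 0 u' d' t)
            \<le> \<gamma> * energy (\<lambda>t. u t - u' t) + (\<delta> - \<epsilon>) * (energy u + energy u')
              + (\<mu> - \<epsilon>) * energy d - \<eta> * energy d'"
  shows "similar \<gamma> \<delta> S S'"
  unfolding similar_iff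
proof (intro conjI assms(1,2))
  show "\<exists>\<epsilon>>0. \<exists>\<eta>>0. \<exists>\<mu>>0. \<forall>u u' d. sq_integrable u \<longrightarrow> sq_integrable u' \<longrightarrow> sq_integrable d \<longrightarrow>
        (\<exists>d'. sq_integrable d' \<and>
          sq_integrable (\<lambda>t. lti_output S 0 0 u d t - lti_output S' 0 0 u' d' t) \<and>
          energy (\<lambda>t. lti_output S 0 0 u d t - lti_output S' 0 0 u' d' t)
            \<le> \<gamma> * energy (\<lambda>t. u t - u' t) + (\<delta> - \<epsilon>) * (energy u + energy u')
              + (\<mu> - \<epsilon>) * energy d - \<eta> * energy d')"
    by (rule exI[of _ \<epsilon>], rule conjI[OF assms(3)], rule exI[of _ \<eta>], rule conjI[OF assms(4)],
        rule exI[of _ \<mu>], rule conjI[OF assms(5)]) (intro allI impI assms(6))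
qed

theorem proposition5:
  fixes S1 :: "('n1::finite, 'm::finite, 'q1::finite, 'p::finite) lti"
    and S1' :: "('k1::finite, 'm, 'r1::finite, 'p) lti"
    and S2 :: "('n2::finite, 'p, 'q2::finite, 'l::finite) lti"
    and S2' :: "('k2::finite, 'p, 'r2::finite, 'l) lti"
    and \<gamma>1 \<delta>1 \<gamma>2 \<delta>2 :: real
  assumes "zero_asymp_stable S1" and "zero_asymp_stable S1'"
    and "zero_asymp_stable S2" and "zero_asymp_stable S2'"
    and "\<gamma>1 > 0" and "\<delta>1 > 0" and "\<gamma>2 > 0" and "\<delta>2 > 0"
    and "similar \<gamma>1 \<delta>1 S1 S1'"
    and "similar \<gamma>2 \<delta>2 S2 S2'"
  shows "\<exists>\<gamma>s>0. \<exists>\<delta>s>0. similar \<gamma>s \<delta>s (series S1 S2) (series S1' S2')"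
proof -
  obtain g where g: "g \<ge> 0"
    and Y1sq: "\<And>u d. sq_integrable u \<Longrightarrow> sq_integrable d \<Longrightarrow> sq_integrable (lti_output S1 0 0 u d)"
    and Y1en: "\<And>u d. sq_integrable u \<Longrightarrow> sq_integrable d \<Longrightarrow>
       energy (lti_output S1 0 0 u d) \<le> g * (energy u + energy d)"
    using stable_output_bound[OF assms(1)] by blast
  obtain e1 h1 m1 where pos1: "e1 > 0" "h1 > 0" "m1 > 0"
    and sim1: "\<forall>u u' d. sq_integrable u \<longrightarrow> sq_integrable u' \<longrightarrow> sq_integrable d \<longrightarrow>
        (\<exists>d'. sq_integrable d' \<and>
          sq_integrable (\<lambda>t. lti_output S1 0 0 u d t - lti_output S1' 0 0 u' d' t) \<and>
          energy (\<lambda>t. lti_output S1 0 0 u d t - lti_output S1' 0 0 u' d' t)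
            \<le> \<gamma>1 * energy (\<lambda>t. u t - u' t) + (\<delta>1 - e1) * (energy u + energy u')
              + (m1 - e1) * energy d - h1 * energy d')"
    using assms(9) unfolding similar_iff by blast
  obtain e2 h2 m2 where pos2: "e2 > 0" "h2 > 0" "m2 > 0"
    and sim2: "\<forall>u u' d. sq_integrable u \<longrightarrow> sq_integrable u' \<longrightarrow> sq_integrable d \<longrightarrow>
        (\<exists>d'. sq_integrable d' \<and>
          sq_integrable (\<lambda>t. lti_output S2 0 0 u d t - lti_output S2' 0 0 u' d' t) \<and>
          energy (\<lambda>t. lti_output S2 0 0 u d t - lti_output S2' 0 0 u' d' t)
            \<le> \<gamma>2 * energy (\<lambda>t. u t - u' t) + (\<delta>2 - e2) * (energy u + energy u')
              + (m2 - e2) * energy d - h2 * energy d')"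
    using assms(10) unfolding similar_iff by blast
  \<comment> \<open>\<open>c\<close> bounds the weight of the inputs of the second systems, and \<open>K\<close> is the total weight of
    \<open>energy (y1 - y1')\<close> below. The series similarity uses \<open>\<epsilon> = 1\<close>; the remaining constants are
    chosen just large (or, for \<open>\<eta>s\<close>, small) enough for the final estimate.\<close>
  define c where "c = max (\<delta>2 - e2) 0"
  define K where "K = \<gamma>2 + 2 * c"
  define \<delta>s where "\<delta>s = 1 + max 0 (K * (\<delta>1 - e1) + 3 * c * g)"
  define \<mu>s where "\<mu>s = 1 + max 0 (max (K * (m1 - e1) + 3 * c * g) (m2 - e2))"
  define \<eta>s where "\<eta>s = min (K * h1) h2"
  have c: "c \<ge> 0" "\<delta>2 - e2 \<le> c" by (auto simp: c_def)
  have K: "K > 0" using assms(7) c by (simp add: K_def)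
  have main: "\<exists>d'. sq_integrable d' \<and>
          sq_integrable (\<lambda>t. lti_output (series S1 S2) 0 0 u d t - lti_output (series S1' S2') 0 0 u' d' t) \<and>
          energy (\<lambda>t. lti_output (series S1 S2) 0 0 u d t - lti_output (series S1' S2') 0 0 u' d' t)
            \<le> (K * \<gamma>1) * energy (\<lambda>t. u t - u' t) + (\<delta>s - 1) * (energy u + energy u')
              + (\<mu>s - 1) * energy d - \<eta>s * energy d'"
    if u: "sq_integrable u" and u': "sq_integrable u'" and d: "sq_integrable d" for u u' d
  proof -
    obtain d1 d2 where d_eq: "d = (\<lambda>t. col (d1 t) (d2 t))" and d1: "sq_integrable d1" and d2: "sq_integrable d2"
      using sq_integrable_colE[OF d] by blast
    define y1 where "y1 = lti_output S1 0 0 u d1"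
    have y1: "sq_integrable y1" "energy y1 \<le> g * (energy u + energy d1)"
      unfolding y1_def by (intro Y1sq Y1en u d1)+
    obtain d1' where d1': "sq_integrable d1'"
      and diff1: "sq_integrable (\<lambda>t. y1 t - lti_output S1' 0 0 u' d1' t)"
      and est1: "energy (\<lambda>t. y1 t - lti_output S1' 0 0 u' d1' t)
            \<le> \<gamma>1 * energy (\<lambda>t. u t - u' t) + (\<delta>1 - e1) * (energy u + energy u')
              + (m1 - e1) * energy d1 - h1 * energy d1'"
      using sim1[rule_format, OF u u' d1] unfolding y1_def by blast
    define y1' where "y1' = lti_output S1' 0 0 u' d1'"
    note diff1 = diff1[folded y1'_def] and est1 = est1[folded y1'_def]
    have y1': "sq_integrable y1'" "energy y1' \<le> 2 * energy y1 + 2 * energy (\<lambda>t. y1 t - y1' t)"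
      using sq_integrable_diff[OF y1(1) diff1] by simp_all
    obtain d2' where d2': "sq_integrable d2'"
      and diff2: "sq_integrable (\<lambda>t. lti_output S2 0 0 y1 d2 t - lti_output S2' 0 0 y1' d2' t)"
      and est2: "energy (\<lambda>t. lti_output S2 0 0 y1 d2 t - lti_output S2' 0 0 y1' d2' t)
            \<le> \<gamma>2 * energy (\<lambda>t. y1 t - y1' t) + (\<delta>2 - e2) * (energy y1 + energy y1')
              + (m2 - e2) * energy d2 - h2 * energy d2'"
      using sim2[rule_format, OF y1(1) y1'(1) d2] by blast
    define d' where "d' t = col (d1' t) (d2' t)" for t
    have d': "sq_integrable d'" "energy d' = energy d1' + energy d2'"
      unfolding d'_def using sq_integrable_col[OF d1' d2'] by auto
    have d_en: "energy d = energy d1 + energy d2"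
      unfolding d_eq using sq_integrable_col[OF d1 d2] by auto
    have out: "lti_output (series S1 S2) 0 0 u d t - lti_output (series S1' S2') 0 0 u' d' t
        = lti_output S2 0 0 y1 d2 t - lti_output S2' 0 0 y1' d2' t" if "t \<ge> 0" for t
      unfolding d_eq d'_def[abs_def] y1_def y1'_def
      by (simp add: lti_output_series assms(1-4) u u' d1 d2 d1' d2' that)
    note nonneg = energy_nonneg[OF u] energy_nonneg[OF u'] energy_nonneg[OF y1(1)] energy_nonneg[OF y1'(1)]
      energy_nonneg[OF d1] energy_nonneg[OF d2] energy_nonneg[OF d1'] energy_nonneg[OF d2']
    have "energy (\<lambda>t. lti_output (series S1 S2) 0 0 u d t - lti_output (series S1' S2') 0 0 u' d' t)
        \<le> \<gamma>2 * energy (\<lambda>t. y1 t - y1' t) + (\<delta>2 - e2) * (energy y1 + energy y1')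
              + (m2 - e2) * energy d2 - h2 * energy d2'"
      using est2 sq_integrable_cong(2)[OF out] by simp
    also have "\<dots> \<le> \<gamma>2 * energy (\<lambda>t. y1 t - y1' t) + c * (3 * energy y1 + 2 * energy (\<lambda>t. y1 t - y1' t))
        + (m2 - e2) * energy d2 - h2 * energy d2'"
    proof (intro diff_right_mono add_right_mono add_left_mono)
      show "(\<delta>2 - e2) * (energy y1 + energy y1') \<le> c * (3 * energy y1 + 2 * energy (\<lambda>t. y1 t - y1' t))"
        using c nonneg y1'(2) by (intro mult_mono) auto
    qed
    also have "\<dots> = K * energy (\<lambda>t. y1 t - y1' t) + 3 * c * energy y1 + (m2 - e2) * energy d2 - h2 * energy d2'"
      by (simp add: K_def algebra_simps)
    also have "\<dots> \<le> K * (\<gamma>1 * energy (\<lambda>t. u t - u' t) + (\<delta>1 - e1) * (energy u + energy u')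
              + (m1 - e1) * energy d1 - h1 * energy d1')
          + 3 * c * (g * ((energy u + energy u') + energy d1)) + (m2 - e2) * energy d2 - h2 * energy d2'"
    proof (intro diff_right_mono add_right_mono add_mono mult_left_mono est1)
      have "g * (energy u + energy d1) \<le> g * ((energy u + energy u') + energy d1)"
        using g nonneg by (intro mult_left_mono) auto
      with y1(2) show "energy y1 \<le> g * ((energy u + energy u') + energy d1)" by linarith
    qed (use K c in auto)
    also have "\<dots> = (K * \<gamma>1) * energy (\<lambda>t. u t - u' t) + (K * (\<delta>1 - e1) + 3 * c * g) * (energy u + energy u')
          + ((K * (m1 - e1) + 3 * c * g) * energy d1 + (m2 - e2) * energy d2) - (K * h1 * energy d1' + h2 * energy d2')"
      by (simp add: algebra_simps)
    also have "\<dots> \<le> (K * \<gamma>1) * energy (\<lambda>t. u t - u' t) + (\<delta>s - 1) * (energy u + energy u')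
          + ((\<mu>s - 1) * energy d1 + (\<mu>s - 1) * energy d2) - (\<eta>s * energy d1' + \<eta>s * energy d2')"
    proof -
      have "K * (\<delta>1 - e1) + 3 * c * g \<le> \<delta>s - 1" "K * (m1 - e1) + 3 * c * g \<le> \<mu>s - 1" "m2 - e2 \<le> \<mu>s - 1"
        "\<eta>s \<le> K * h1" "\<eta>s \<le> h2"
        by (auto simp: \<delta>s_def \<mu>s_def \<eta>s_def)
      then show ?thesis
        by (intro diff_mono[OF add_mono[OF add_mono[OF order_refl]]] add_mono mult_right_mono add_nonneg_nonneg nonneg)
    qed
    also have "\<dots> = (K * \<gamma>1) * energy (\<lambda>t. u t - u' t) + (\<delta>s - 1) * (energy u + energy u')
          + (\<mu>s - 1) * energy d - \<eta>s * energy d'"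
      by (simp add: d_en d'(2) distrib_left)
    finally have "energy (\<lambda>t. lti_output (series S1 S2) 0 0 u d t - lti_output (series S1' S2') 0 0 u' d' t)
        \<le> (K * \<gamma>1) * energy (\<lambda>t. u t - u' t) + (\<delta>s - 1) * (energy u + energy u')
          + (\<mu>s - 1) * energy d - \<eta>s * energy d'" .
    moreover have "sq_integrable (\<lambda>t. lti_output (series S1 S2) 0 0 u d t - lti_output (series S1' S2') 0 0 u' d' t)"
      using diff2 sq_integrable_cong(1)[OF out] by simp
    ultimately show ?thesis using d'(1) by (intro exI[of _ d'] conjI)
  qed
  have pos: "\<eta>s > 0" "\<mu>s > 0" "\<delta>s > 0" "K * \<gamma>1 > 0"
    using K pos1 pos2 assms(5) by (auto simp: \<eta>s_def \<mu>s_def \<delta>s_def)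
  have "similar (K * \<gamma>1) \<delta>s (series S1 S2) (series S1' S2')"
    by (rule similarI[OF _ _ zero_less_one pos(1,2) main])
      (simp_all only: zero_asymp_stable_series assms(1-4))
  then show ?thesis using pos by blast
qed

end
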